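(* For every integer $d\ge3$, \[ \beta\left(1-\frac{6}{5d}\right)(1+\sqrt2)^d\le C(d,2)\le(1+\sqrt2)^d. \] In particular, \[ \beta\le\liminf_{d\to\infty}\frac{C(d,2)}{(1+\sqrt2)^d}\le\limsup_{d\to\infty}\frac{C(d,2)}{(1+\sqrt2)^d}\le1, \] and \[ \lim_{d\to\infty}C(d,2)^{1/d}=1+\sqrt2. \]
   Context: The constant $\beta$ is \[ \beta:=\frac{15\pi}{2\bigl(5\sqrt{26}+\log(5+\sqrt{26})\bigr)}\approx0.8473222863, \] with $\log$ the natural logarithm. Let $\mathbb T=\{z\in\mathbb C:|z|=1\}$. For a polynomial $P:\mathbb C^N\to\mathbb C$ and a nonempty compact set $E\subset\mathbb C^N$, put $\|P\|_E=\max_{z\in E}|P(z)|$. The set $\{-1,1\}^N$ is regarded as a subset of $\mathbb C^N$. For integers $N\ge d\ge1$, let $\mathcal P_{N,d}^{\mathrm{mult}}$ be the set of multiaffine polynomials $P:\mathbb C^N\to\mathbb C$ with complex coefficients and total degree at most $d$, i.e. \[ P(z)=\sum_{\substack{\alpha\in\{0,1\}^N\\ |\alpha|\le d}}c_\alpha z^\alpha,\qquad c_\alpha\in\mathbb C, \] where $|\alpha|=\alpha_1+\cdots+\alpha_N$ and $z^\alpha=z_1^{\alpha_1}\cdots z_N^{\alpha_N}$. Define \[ C(d,2):=\sup_{N\ge d}\ \sup_{0\ne P\in\mathcal P_{N,d}^{\mathrm{mult}}}\frac{\|P\|_{\mathbb T^N}}{\|P\|_{\{-1,1\}^N}}. \]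 *)

theory Defs
  imports "HOL-Analysis.Analysis"
begin

definition beta_const :: real where
  "beta_const = 15 * pi / (2 * (5 * sqrt 26 + ln (5 + sqrt 26)))"

text \<open>
  The dimension varies inside the supremum defining \<open>C(d,2)\<close>, so points of \<open>X\<^sup>N\<close> are the
  extensional functions \<open>{..<N} \<rightarrow>\<^sub>E X\<close> (coordinates indexed from 0).
\<close>

definition cspace :: "nat \<Rightarrow> (nat \<Rightarrow> complex) set" where
  "cspace N = {..<N} \<rightarrow>\<^sub>E UNIV"

definition torus :: "nat \<Rightarrow> (nat \<Rightarrow> complex) set" where
  "torus N = {..<N} \<rightarrow>\<^sub>E {z. cmod z = 1}"

definition hypercube :: "nat \<Rightarrow> (nat \<Rightarrow> complex) set" where
  "hypercube N = {..<N} \<rightarrow>\<^sub>E {-1, 1}"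

text \<open>Used only for nonempty compact \<open>E\<close> and polynomials \<open>P\<close>, where the supremum is a maximum.\<close>

definition sup_norm :: "(nat \<Rightarrow> complex) set \<Rightarrow> ((nat \<Rightarrow> complex) \<Rightarrow> complex) \<Rightarrow> real" where
  "sup_norm E P = (SUP z\<in>E. cmod (P z))"

definition multiaffine_indices :: "nat \<Rightarrow> nat \<Rightarrow> (nat \<Rightarrow> nat) set" where
  "multiaffine_indices N d = {\<alpha> \<in> {..<N} \<rightarrow>\<^sub>E {0, 1}. (\<Sum>i<N. \<alpha> i) \<le> d}"

definition multiaffine_polys :: "nat \<Rightarrow> nat \<Rightarrow> ((nat \<Rightarrow> complex) \<Rightarrow> complex) set" where
  "multiaffine_polys N d =
     {P. \<exists>c. \<forall>z. P z = (\<Sum>\<alpha>\<in>multiaffine_indices N d. c \<alpha> * (\<Prod>i<N. z i ^ \<alpha> i))}"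

text \<open>
  The constant \<open>C(d,2)\<close>. The supremum is taken in the extended reals, so that its finiteness is not
  presupposed. A nonzero multiaffine polynomial does not vanish identically on the hypercube, so
  the denominator is never zero.
\<close>

definition C2 :: "nat \<Rightarrow> ereal" where
  "C2 d = (SUP N\<in>{d..}. SUP P\<in>{P \<in> multiaffine_polys N d. \<exists>z\<in>cspace N. P z \<noteq> 0}.
             ereal (sup_norm (torus N) P) / ereal (sup_norm (hypercube N) P))"

end

theory Submission
  imports Defs "HOL-Complex_Analysis.Complex_Analysis" "HOL-Real_Asymp.Real_Asymp"
begin

text \<open>
  Upper bound: being affine in every coordinate, \<open>P\<close> is bounded on the cube \<open>[-1, 1]\<^sup>N\<close> by its norm on
  the vertices, and it suffices to bound it on the ellipse with semi-axes \<open>\<surd>2\<close> and \<open>1\<close>, whose convex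
  hull contains the unit circle. This ellipse is the image of \<open>\<bar>w\<bar> = 1 + \<surd>2\<close> under the Joukowski map
  \<open>(w + 1 / w) / 2\<close>, so the maximum principle applies in a common scaling factor of the \<open>w\<^sub>i\<close>.

  Lower bound: replacing a variable by a mean of many \<open>\<plusminus>1\<close> variables, one may use arbitrary
  polynomials of degree at most \<open>d\<close> on the cube instead of multiaffine ones on its vertices. Take
  \<open>\<Sum>\<^sub>j cis (- s\<^sub>j) q (x\<^sub>j, y\<^sub>j)\<close> with equidistributed \<open>s\<^sub>j\<close>: on the cube its modulus is at most the mean
  width of \<open>q ([-1, 1]\<^sup>2)\<close>, while at suitable points of the torus near \<open>\<i>\<close> all summands have the same
  phase. For \<open>d \<le> 10\<close> the Chebyshev polynomial \<open>q = T\<^sub>d (x)\<close> is good enough. For larger \<open>d = k + l\<close> with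
  \<open>k = \<lfloor>d / 2\<rfloor>\<close> one takes
  \<open>q = (T\<^sub>d (x) - T\<^sub>d (y)) / 2 + (2 / 5) \<i> (T\<^sub>k (x) T\<^sub>l (y) + T\<^sub>l (x) T\<^sub>k (y)) / 2\<close>, whose values lie in the
  lens \<open>\<bar>Re q\<bar> \<le> 1 - u\<^sup>2\<close>, \<open>Im q = 2 u / 5\<close>; the perimeter of this lens is the denominator of \<open>\<beta>\<close>.
\<close>

section \<open>The upper bound\<close>

lemma finite_multiaffine_indices [simp]: "finite (multiaffine_indices N d)"
  unfolding multiaffine_indices_def by (rule finite_subset[of _ "{..<N} \<rightarrow>\<^sub>E {0, 1}"]) (auto intro: finite_PiE)

lemma multiaffine_indexD:
  assumes "\<alpha> \<in> multiaffine_indices N d"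
  shows "i < N \<Longrightarrow> \<alpha> i = 0 \<or> \<alpha> i = 1" "(\<Sum>i<N. \<alpha> i) \<le> d"
  using assms by (auto simp: multiaffine_indices_def PiE_iff)

lemma multiaffine_cong:
  assumes "P \<in> multiaffine_polys N d" "\<And>i. i < N \<Longrightarrow> z i = w i"
  shows "P z = P w"
  using assms by (force simp: multiaffine_polys_def intro!: sum.cong prod.cong)

lemma multiaffine_affine_coordinate:
  assumes P: "P \<in> multiaffine_polys N d" and i: "i < N"
  shows "P (z(i := (1 - of_real t) * a + of_real t * b)) =
         (1 - of_real t) * P (z(i := a)) + of_real t * P (z(i := b))"
proof -
  obtain c where c: "\<And>z. P z = (\<Sum>\<alpha>\<in>multiaffine_indices N d. c \<alpha> * (\<Prod>i<N. z i ^ \<alpha> i))"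
    using P by (auto simp: multiaffine_polys_def)
  have split: "(\<Prod>j<N. (z(i := x)) j ^ \<alpha> j) = x ^ \<alpha> i * (\<Prod>j\<in>{..<N} - {i}. z j ^ \<alpha> j)" for x \<alpha>
  proof -
    have "(\<Prod>j<N. (z(i := x)) j ^ \<alpha> j) =
          (z(i := x)) i ^ \<alpha> i * (\<Prod>j\<in>{..<N} - {i}. (z(i := x)) j ^ \<alpha> j)"
      using i by (subst prod.remove[of _ i]) auto
    also have "(\<Prod>j\<in>{..<N} - {i}. (z(i := x)) j ^ \<alpha> j) = (\<Prod>j\<in>{..<N} - {i}. z j ^ \<alpha> j)"
      by (intro prod.cong) auto
    finally show ?thesis by simp
  qed
  show ?thesis unfolding c split sum_distrib_left sum.distrib[symmetric]
  proof (intro sum.cong refl)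
    fix \<alpha> assume "\<alpha> \<in> multiaffine_indices N d"
    then have "\<alpha> i = 0 \<or> \<alpha> i = 1" using i multiaffine_indexD by blast
    then show "c \<alpha> * (((1 - of_real t) * a + of_real t * b) ^ \<alpha> i * (\<Prod>j\<in>{..<N} - {i}. z j ^ \<alpha> j)) =
       (1 - of_real t) * (c \<alpha> * (a ^ \<alpha> i * (\<Prod>j\<in>{..<N} - {i}. z j ^ \<alpha> j))) +
       of_real t * (c \<alpha> * (b ^ \<alpha> i * (\<Prod>j\<in>{..<N} - {i}. z j ^ \<alpha> j)))"
      by (auto simp: algebra_simps)
  qed
qed

text \<open>Coordinates pass from \<open>A\<close> to \<open>B\<close> one at a time. With the
  others fixed, \<open>P\<close> is affine in the moving coordinate, so its value is a convex
  combination of two values already bounded by \<open>M\<close>.\<close>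

lemma multiaffine_bound_convex:
  assumes P: "P \<in> multiaffine_polys N d"
    and bound: "\<And>z. (\<And>i. i < N \<Longrightarrow> z i \<in> A) \<Longrightarrow> cmod (P z) \<le> M"
    and conv: "\<And>b. b \<in> B \<Longrightarrow> \<exists>x\<in>A. \<exists>y\<in>A. \<exists>t\<in>{0..1}. b = (1 - of_real t) * x + of_real t * y"
    and z: "\<And>i. i < N \<Longrightarrow> z i \<in> B"
  shows "cmod (P z) \<le> M"
proof -
  have "cmod (P z) \<le> M" if "k \<le> N" "\<And>i. i < k \<Longrightarrow> z i \<in> B" "\<And>i. k \<le> i \<Longrightarrow> i < N \<Longrightarrow> z i \<in> A" for k z
    using that
  proof (induction k arbitrary: z)
    case 0
    then show ?case using bound by simp
  next
    case (Suc k)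
    then obtain x y t where xy: "x \<in> A" "y \<in> A" "t \<in> {0..1}"
      and t: "z k = (1 - of_real t) * x + of_real t * y"
      using conv by (meson lessI)
    have *: "cmod (P (z(k := v))) \<le> M" if "v \<in> A" for v
      using Suc.prems that by (intro Suc.IH) auto
    have "P z = P (z(k := (1 - of_real t) * x + of_real t * y))"
      by (simp flip: t)
    also have "\<dots> = (1 - of_real t) * P (z(k := x)) + of_real t * P (z(k := y))"
      using Suc.prems by (intro multiaffine_affine_coordinate[OF P]) auto
    also have "cmod \<dots> \<le> (1 - t) * cmod (P (z(k := x))) + t * cmod (P (z(k := y)))"
      using xy(3) norm_of_real[of "1 - t", where 'a = complex]
      by (intro order.trans[OF norm_triangle_ineq]) (simp add: norm_mult)
    also have "\<dots> \<le> (1 - t) * M + t * M"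
      using xy * by (intro add_mono mult_left_mono) auto
    finally show ?case by (simp add: algebra_simps)
  qed
  from this[of N z] z show ?thesis by simp
qed

lemma multiaffine_bound_cube:
  assumes "P \<in> multiaffine_polys N d"
    and "\<And>z. (\<And>i. i < N \<Longrightarrow> z i \<in> {-1, 1}) \<Longrightarrow> cmod (P z) \<le> M"
    and "\<And>i. i < N \<Longrightarrow> z i \<in> of_real ` {-1..1}"
  shows "cmod (P z) \<le> M"
proof (rule multiaffine_bound_convex[OF assms(1,2) _ assms(3)])
  fix b :: complex assume "b \<in> of_real ` {-1..1}"
  then obtain r where "b = of_real r" "r \<in> {-1..1}" by auto
  then show "\<exists>x\<in>{-1, 1}. \<exists>y\<in>{-1, 1}. \<exists>t\<in>{0..1}. b = (1 - of_real t) * x + of_real t * y"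
    by (intro bexI[of _ "-1" "{-1, 1}"] bexI[of _ 1 "{-1, 1}"] bexI[of _ "(r + 1) / 2" "{0..1}"])
      (auto simp: field_simps)
qed auto

text \<open>The factor \<open>\<mu> ^ d\<close> clears the poles that \<open>1 / \<mu>\<close>
  causes in monomials of degree at most \<open>d\<close>, so \<open>g\<close> is a polynomial in
  \<open>\<mu>\<close>. On the unit circle the arguments of \<open>P\<close> are real and lie in
  \<open>[-1, 1]\<close>; the inner point \<open>\<mu> = 1 / R\<close> gives the ellipse.\<close>

lemma multiaffine_bound_ellipse:
  assumes P: "P \<in> multiaffine_polys N d"
    and bound: "\<And>z. (\<And>i. i < N \<Longrightarrow> z i \<in> {-1, 1}) \<Longrightarrow> cmod (P z) \<le> M"
    and R: "R \<ge> 1"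
  shows "cmod (P (\<lambda>i. (of_real R * cis (\<theta> i) + cis (- \<theta> i) / of_real R) / 2)) \<le> R ^ d * M"
proof -
  obtain c where c: "\<And>z. P z = (\<Sum>\<alpha>\<in>multiaffine_indices N d. c \<alpha> * (\<Prod>i<N. z i ^ \<alpha> i))"
    using P by (auto simp: multiaffine_polys_def)
  define g where "g = (\<lambda>\<mu>. \<Sum>\<alpha>\<in>multiaffine_indices N d. c \<alpha> * (\<mu> ^ (d - (\<Sum>i<N. \<alpha> i)) *
     (\<Prod>i<N. ((cis (\<theta> i) + \<mu>\<^sup>2 * cis (- \<theta> i)) / 2) ^ \<alpha> i)))"
  have hol: "g holomorphic_on UNIV"
    unfolding g_def by (intro holomorphic_intros) auto
  have g_eq: "g \<mu> = \<mu> ^ d * P (\<lambda>i. (cis (\<theta> i) / \<mu> + \<mu> * cis (- \<theta> i)) / 2)" if "\<mu> \<noteq> 0" for \<mu>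
    unfolding g_def c sum_distrib_left
  proof (intro sum.cong refl)
    fix \<alpha> assume \<alpha>: "\<alpha> \<in> multiaffine_indices N d"
    have "(\<Prod>i<N. ((cis (\<theta> i) / \<mu> + \<mu> * cis (- \<theta> i)) / 2) ^ \<alpha> i) =
          (\<Prod>i<N. ((cis (\<theta> i) + \<mu>\<^sup>2 * cis (- \<theta> i)) / 2) ^ \<alpha> i / \<mu> ^ \<alpha> i)"
      using that by (intro prod.cong refl) (simp add: field_simps power2_eq_square flip: power_divide)
    also have "\<dots> = (\<Prod>i<N. ((cis (\<theta> i) + \<mu>\<^sup>2 * cis (- \<theta> i)) / 2) ^ \<alpha> i) / \<mu> ^ (\<Sum>i<N. \<alpha> i)"
      by (simp add: prod_dividef power_sum)
    finally show "c \<alpha> * (\<mu> ^ (d - (\<Sum>i<N. \<alpha> i)) *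
        (\<Prod>i<N. ((cis (\<theta> i) + \<mu>\<^sup>2 * cis (- \<theta> i)) / 2) ^ \<alpha> i)) =
      \<mu> ^ d * (c \<alpha> * (\<Prod>i<N. ((cis (\<theta> i) / \<mu> + \<mu> * cis (- \<theta> i)) / 2) ^ \<alpha> i))"
      using that multiaffine_indexD(2)[OF \<alpha>] by (simp add: power_diff)
  qed
  have "cmod (g (of_real (1 / R))) \<le> M"
  proof (rule maximum_modulus_frontier[of g "cball 0 1"])
    show "g holomorphic_on interior (cball 0 1)" "continuous_on (closure (cball 0 1)) g"
      using hol by (auto intro: holomorphic_on_subset holomorphic_on_imp_continuous_on)
    show "complex_of_real (1 / R) \<in> cball 0 1" using R by (simp add: norm_divide)
    fix \<mu> :: complex assume "\<mu> \<in> frontier (cball 0 1)"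
    then have "cmod \<mu> = 1" by simp
    then obtain t where t: "\<mu> = cis t" by (metis rcis_cmod_Arg rcis_def mult_1 of_real_1)
    have "cmod (P (\<lambda>i. (cis (\<theta> i) / \<mu> + \<mu> * cis (- \<theta> i)) / 2)) \<le> M"
    proof (rule multiaffine_bound_cube[OF P bound])
      fix i
      have "(cis (\<theta> i) / \<mu> + \<mu> * cis (- \<theta> i)) / 2 = of_real (cos (\<theta> i - t))"
        using sin_minus[of "\<theta> i - t"] by (simp add: t cis_divide cis_mult complex_eq_iff cos_diff)
      then show "(cis (\<theta> i) / \<mu> + \<mu> * cis (- \<theta> i)) / 2 \<in> of_real ` {-1..1}" by auto
    qed auto
    then show "cmod (g \<mu>) \<le> M" using \<open>cmod \<mu> = 1\<close>
      by (subst g_eq) (auto simp: norm_mult norm_power)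
  qed auto
  moreover have "g (of_real (1 / R)) =
      P (\<lambda>i. (of_real R * cis (\<theta> i) + cis (- \<theta> i) / of_real R) / 2) / of_real R ^ d"
    using R by (subst g_eq) (simp_all add: mult.commute power_one_over)
  ultimately show ?thesis
    using R by (simp del: of_real_divide add: norm_divide norm_power pos_divide_le_eq mult.commute)
qed

text \<open>For \<open>R = 1 + sqrt 2\<close> the semi-axes \<open>(R + 1 / R) / 2\<close> and
  \<open>(R - 1 / R) / 2\<close> are \<open>sqrt 2\<close> and \<open>1\<close>. The point
  \<open>cis t\<close> lies on the horizontal chord of this ellipse that joins the parameters
  \<open>t\<close> and \<open>pi - t\<close>.\<close>

lemma multiaffine_bound_torus:
  assumes P: "P \<in> multiaffine_polys N d"
    and bound: "\<And>z. (\<And>i. i < N \<Longrightarrow> z i \<in> {-1, 1}) \<Longrightarrow> cmod (P z) \<le> M"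
    and z: "\<And>i. i < N \<Longrightarrow> cmod (z i) = 1"
  shows "cmod (P z) \<le> (1 + sqrt 2) ^ d * M"
proof (rule multiaffine_bound_convex[OF P])
  define E where "E = range (\<lambda>\<theta>. Complex (sqrt 2 * cos \<theta>) (sin \<theta>))"
  fix w assume "\<And>i. i < N \<Longrightarrow> w i \<in> E"
  then have "\<forall>i. \<exists>\<theta>. i < N \<longrightarrow> w i = Complex (sqrt 2 * cos \<theta>) (sin \<theta>)"
    by (auto simp: E_def)
  then obtain \<theta> where \<theta>: "\<And>i. i < N \<Longrightarrow> w i = Complex (sqrt 2 * cos (\<theta> i)) (sin (\<theta> i))"
    by metis
  have "(sqrt 2 - 1) * (1 + sqrt 2) = 1" "1 + sqrt 2 \<noteq> 0"
    by (simp add: algebra_simps) (smt (verit) real_sqrt_ge_zero)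
  then have inv: "1 / (1 + sqrt 2) = sqrt 2 - 1"
    by (metis eq_divide_imp)
  have "w i = (of_real (1 + sqrt 2) * cis (\<theta> i) + cis (- \<theta> i) / of_real (1 + sqrt 2)) / 2" if "i < N" for i
  proof -
    have "cis (- \<theta> i) / of_real (1 + sqrt 2) = of_real (1 / (1 + sqrt 2)) * cis (- \<theta> i)"
      by simp
    also have "\<dots> = of_real (sqrt 2 - 1) * cis (- \<theta> i)"
      unfolding inv ..
    finally have "cis (- \<theta> i) / of_real (1 + sqrt 2) = of_real (sqrt 2 - 1) * cis (- \<theta> i)" .
    then show ?thesis unfolding \<theta>[OF that] by (simp add: complex_eq_iff algebra_simps)
  qed
  then have "P w = P (\<lambda>i. (of_real (1 + sqrt 2) * cis (\<theta> i) + cis (- \<theta> i) / of_real (1 + sqrt 2)) / 2)"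
    by (intro multiaffine_cong[OF P]) auto
  then show "cmod (P w) \<le> (1 + sqrt 2) ^ d * M"
    using multiaffine_bound_ellipse[OF P bound, of "1 + sqrt 2" \<theta>] by simp
next
  fix b :: complex assume "b \<in> sphere 0 1"
  then have "cmod b = 1" by simp
  then obtain t where t: "b = cis t" by (metis rcis_cmod_Arg rcis_def mult_1 of_real_1)
  let ?E = "range (\<lambda>\<theta>. Complex (sqrt 2 * cos \<theta>) (sin \<theta>))"
  \<comment> \<open>The weight solves \<open>(2 * s - 1) * sqrt 2 = 1\<close>, which brings the
    abscissa from \<open>sqrt 2 * cos t\<close> down to \<open>cos t\<close>.\<close>
  define s where "s = (1 + 1 / sqrt 2) / 2"
  have "1 / sqrt 2 \<le> 1" by simp
  then have s: "s \<in> {0..1}" by (simp add: s_def)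
  have "(2 * s - 1) * sqrt 2 = 1" by (simp add: s_def algebra_simps real_div_sqrt)
  then have *: "(1 - s) * (sqrt 2 * cos (pi - t)) + s * (sqrt 2 * cos t) = cos t"
    by (simp add: algebra_simps) algebra
  have "b = (1 - of_real s) * Complex (sqrt 2 * cos (pi - t)) (sin (pi - t)) +
            of_real s * Complex (sqrt 2 * cos t) (sin t)"
    using * by (simp add: t complex_eq_iff algebra_simps)
  then show "\<exists>x\<in>?E. \<exists>y\<in>?E. \<exists>s\<in>{0..1}. b = (1 - of_real s) * x + of_real s * y"
    using s by blast
qed (use z in auto)

section \<open>Comparison of the two norms and bounds for their quotient\<close>

lemma sup_norm_torus_le:
  assumes P: "P \<in> multiaffine_polys N d"
  shows "sup_norm (torus N) P \<le> (1 + sqrt 2) ^ d * sup_norm (hypercube N) P"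
    and "bdd_above ((\<lambda>z. cmod (P z)) ` torus N)"
    and "sup_norm (hypercube N) P \<ge> 0"
proof -
  have fin: "finite (hypercube N)"
    unfolding hypercube_def by (intro finite_PiE) auto
  have ne: "hypercube N \<noteq> {}" "torus N \<noteq> {}"
    unfolding hypercube_def torus_def PiE_eq_empty_iff by (auto intro: exI[of _ 1])
  have bound: "cmod (P z) \<le> sup_norm (hypercube N) P" if "\<And>i. i < N \<Longrightarrow> z i \<in> {-1, 1}" for z
  proof -
    \<comment> \<open>Points of \<open>hypercube N\<close> are extensional, so \<open>z\<close> is
      first made undefined outside \<open>{..<N}\<close>.\<close>
    have "P z = P (restrict z {..<N})" by (rule multiaffine_cong[OF P]) auto
    moreover have "restrict z {..<N} \<in> hypercube N" using that by (auto simp: hypercube_def)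
    ultimately show ?thesis unfolding sup_norm_def using fin by (auto intro!: cSUP_upper)
  qed
  show "sup_norm (hypercube N) P \<ge> 0"
    using bound[of "\<lambda>_. 1"] norm_ge_zero order.trans by blast
  have le: "cmod (P z) \<le> (1 + sqrt 2) ^ d * sup_norm (hypercube N) P" if "z \<in> torus N" for z
    using that by (intro multiaffine_bound_torus[OF P bound]) (auto simp: torus_def)
  show "sup_norm (torus N) P \<le> (1 + sqrt 2) ^ d * sup_norm (hypercube N) P"
    unfolding sup_norm_def[of "torus N"] using le ne by (intro cSUP_least) auto
  show "bdd_above ((\<lambda>z. cmod (P z)) ` torus N)" using le by (rule bdd_aboveI2)
qed

lemma C2_upper: "C2 d \<le> ereal ((1 + sqrt 2) ^ d)"
  unfolding C2_def
proof (intro SUP_least)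
  fix N P assume "P \<in> {P \<in> multiaffine_polys N d. \<exists>z\<in>cspace N. P z \<noteq> 0}"
  then have P: "P \<in> multiaffine_polys N d" by simp
  note le = sup_norm_torus_le[OF P]
  show "ereal (sup_norm (torus N) P) / ereal (sup_norm (hypercube N) P) \<le> ereal ((1 + sqrt 2) ^ d)"
  proof (cases "sup_norm (hypercube N) P = 0")
    case True
    \<comment> \<open>A zero denominator forces a numerator of at most 0, and
      \<open>0 / 0 = 0\<close> in \<open>ereal\<close>, so the bound survives.\<close>
    then have "sup_norm (torus N) P \<le> 0" using le by simp
    then show ?thesis using True by (cases "sup_norm (torus N) P = 0") (auto simp: divide_ereal_def)
  next
    case False
    then show ?thesis using le by (simp add: divide_le_eq mult.commute)
  qed
qed

text \<open>A vanishing norm on the hypercube is harmless: the extended quotient is then \<open>\<infinity>\<close>.\<close>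

lemma C2_lower:
  assumes P: "P \<in> multiaffine_polys N d" and N: "N \<ge> d"
    and bound: "\<And>z. z \<in> hypercube N \<Longrightarrow> cmod (P z) \<le> B" and B: "B > 0"
    and z: "z \<in> torus N" and v: "cmod (P z) \<ge> v" "v > 0"
  shows "ereal (v / B) \<le> C2 d"
proof -
  have ne: "hypercube N \<noteq> {}"
    unfolding hypercube_def PiE_eq_empty_iff by auto
  have H: "sup_norm (hypercube N) P \<le> B"
    unfolding sup_norm_def using bound ne by (intro cSUP_least) auto
  note H0 = sup_norm_torus_le(3)[OF P]
  have T: "sup_norm (torus N) P \<ge> v"
    unfolding sup_norm_def
    using cSUP_upper[OF z sup_norm_torus_le(2)[OF P]] v by linarith
  have "ereal (v / B) \<le> ereal (sup_norm (torus N) P) / ereal (sup_norm (hypercube N) P)"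
  proof (cases "sup_norm (hypercube N) P = 0")
    case True
    then show ?thesis using T v by (auto simp: divide_ereal_def)
  next
    case False
    then show ?thesis using T H H0 v B by (auto intro!: frac_le)
  qed
  also have "\<dots> \<le> C2 d"
    unfolding C2_def
  proof (rule SUP_upper2[of N], use N in simp, rule SUP_upper)
    show "P \<in> {P \<in> multiaffine_polys N d. \<exists>z\<in>cspace N. P z \<noteq> 0}"
      using P v PiE_mono[of "{..<N}" "\<lambda>_. {z. cmod z = 1}" "\<lambda>_. UNIV"] z
      by (auto simp: cspace_def torus_def intro!: bexI[of _ z])
  qed
  finally show ?thesis .
qed

section \<open>Multiaffine approximation of polynomials\<close>

lemma multiaffine_polys_0: "(\<lambda>z. 0) \<in> multiaffine_polys N d"
  unfolding multiaffine_polys_def by (auto intro: exI[of _ "\<lambda>_. 0"])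

lemma multiaffine_polys_add:
  assumes "P \<in> multiaffine_polys N d" "Q \<in> multiaffine_polys N d"
  shows "(\<lambda>z. P z + Q z) \<in> multiaffine_polys N d"
proof -
  obtain a b where "\<forall>z. P z = (\<Sum>\<alpha>\<in>multiaffine_indices N d. a \<alpha> * (\<Prod>i<N. z i ^ \<alpha> i))"
    "\<forall>z. Q z = (\<Sum>\<alpha>\<in>multiaffine_indices N d. b \<alpha> * (\<Prod>i<N. z i ^ \<alpha> i))"
    using assms by (auto simp: multiaffine_polys_def)
  then show ?thesis unfolding multiaffine_polys_def
    by (auto intro!: exI[of _ "\<lambda>\<alpha>. a \<alpha> + b \<alpha>"] simp: algebra_simps sum.distrib)
qed

lemma multiaffine_polys_cmult:
  assumes "P \<in> multiaffine_polys N d"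
  shows "(\<lambda>z. a * P z) \<in> multiaffine_polys N d"
proof -
  obtain c where "\<forall>z. P z = (\<Sum>\<alpha>\<in>multiaffine_indices N d. c \<alpha> * (\<Prod>i<N. z i ^ \<alpha> i))"
    using assms by (auto simp: multiaffine_polys_def)
  then show ?thesis unfolding multiaffine_polys_def
    by (auto intro!: exI[of _ "\<lambda>\<alpha>. a * c \<alpha>"] simp: algebra_simps sum_distrib_left)
qed

lemma multiaffine_polys_sum:
  assumes "\<And>i. i \<in> I \<Longrightarrow> P i \<in> multiaffine_polys N d"
  shows "(\<lambda>z. \<Sum>i\<in>I. P i z) \<in> multiaffine_polys N d"
  using assms
  by (induction I rule: infinite_finite_induct)
    (auto intro: multiaffine_polys_0 multiaffine_polys_add)

lemma multiaffine_polys_prod: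
  assumes S: "S \<subseteq> {..<N}" "card S \<le> d"
  shows "(\<lambda>z. \<Prod>i\<in>S. z i) \<in> multiaffine_polys N d"
proof -
  define \<beta> :: "nat \<Rightarrow> nat" where "\<beta> = restrict (indicator S) {..<N}"
  have "(\<Sum>i<N. \<beta> i) = card S"
  proof -
    have "(\<Sum>i<N. \<beta> i) = (\<Sum>i<N. indicator S i)" by (simp add: \<beta>_def)
    also have "\<dots> = card S" using S(1) by (simp add: indicator_def sum.If_cases Int_absorb1)
    finally show ?thesis .
  qed
  then have \<beta>: "\<beta> \<in> multiaffine_indices N d"
    using S by (auto simp: multiaffine_indices_def \<beta>_def indicator_def)
  have "(\<Prod>i\<in>S. z i) = (\<Sum>\<alpha>\<in>multiaffine_indices N d. (if \<alpha> = \<beta> then 1 else 0) * (\<Prod>i<N. z i ^ \<alpha> i))" for z :: "nat \<Rightarrow> complex"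
  proof -
    have "(\<Sum>\<alpha>\<in>multiaffine_indices N d. (if \<alpha> = \<beta> then 1 else 0) * (\<Prod>i<N. z i ^ \<alpha> i)) =
          (\<Sum>\<alpha>\<in>multiaffine_indices N d. if \<alpha> = \<beta> then (\<Prod>i<N. z i ^ \<alpha> i) else 0)"
      by (intro sum.cong) auto
    also have "\<dots> = (\<Prod>i<N. z i ^ \<beta> i)"
      using \<beta> by simp
    also have "\<dots> = (\<Prod>i\<in>S. z i)"
      using S(1) by (intro prod.mono_neutral_cong_right) (auto simp: \<beta>_def indicator_def)
    finally show ?thesis by simp
  qed
  then show ?thesis
    unfolding multiaffine_polys_def by (intro CollectI exI[of _ "\<lambda>\<alpha>. if \<alpha> = \<beta> then 1 else 0"]) blast
qed

text \<open>
  A polynomial \<open>F\<close> in \<open>n\<close> variables is imitated by a multiaffine polynomial in \<open>n * M\<close> variables in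
  which the \<open>v\<close>-th variable of \<open>F\<close> becomes the mean over the \<open>v\<close>-th block of length \<open>M\<close>.
\<close>

definition block_mean :: "nat \<Rightarrow> (nat \<Rightarrow> complex) \<Rightarrow> nat \<Rightarrow> complex" where
  "block_mean M z v = (\<Sum>j<M. z (v * M + j)) / of_nat M"

text \<open>The error is uniform on the closed polydisc, which contains the hypercube and the torus,
  so one \<open>Q\<close> serves numerator and denominator. Asking for all large \<open>M\<close>
  makes the notion stable under sums.\<close>

definition approximable :: "nat \<Rightarrow> nat \<Rightarrow> ((nat \<Rightarrow> complex) \<Rightarrow> complex) \<Rightarrow> bool" where
  "approximable n d F \<longleftrightarrow> (\<forall>e>0. \<forall>\<^sub>F M in sequentially. \<exists>Q\<in>multiaffine_polys (n * M) d.
     \<forall>z x. (\<forall>i<n * M. cmod (z i) \<le> 1) \<longrightarrow> (\<forall>v<n. x v = block_mean M z v) \<longrightarrow> cmod (Q z - F x) \<le> e)"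

lemma approximable_0: "approximable n d (\<lambda>x. 0)"
  unfolding approximable_def by (auto intro!: always_eventually bexI[OF _ multiaffine_polys_0])

lemma approximable_add:
  assumes "approximable n d F" "approximable n d G"
  shows "approximable n d (\<lambda>x. F x + G x)"
  unfolding approximable_def
proof (intro allI impI)
  fix e :: real assume "e > 0"
  then have "e / 2 > 0" by simp
  with assms have
    "\<forall>\<^sub>F M in sequentially. \<exists>Q\<in>multiaffine_polys (n * M) d.
     \<forall>z x. (\<forall>i<n * M. cmod (z i) \<le> 1) \<longrightarrow> (\<forall>v<n. x v = block_mean M z v) \<longrightarrow> cmod (Q z - F x) \<le> e / 2"
    "\<forall>\<^sub>F M in sequentially. \<exists>Q\<in>multiaffine_polys (n * M) d.
     \<forall>z x. (\<forall>i<n * M. cmod (z i) \<le> 1) \<longrightarrow> (\<forall>v<n. x v = block_mean M z v) \<longrightarrow> cmod (Q z - G x) \<le> e / 2"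
    unfolding approximable_def by blast+
  then show "\<forall>\<^sub>F M in sequentially. \<exists>Q\<in>multiaffine_polys (n * M) d.
     \<forall>z x. (\<forall>i<n * M. cmod (z i) \<le> 1) \<longrightarrow> (\<forall>v<n. x v = block_mean M z v) \<longrightarrow> cmod (Q z - (F x + G x)) \<le> e"
  proof eventually_elim
    case (elim M)
    then obtain P Q where P: "P \<in> multiaffine_polys (n * M) d"
      "\<And>z x. (\<forall>i<n * M. cmod (z i) \<le> 1) \<Longrightarrow> (\<forall>v<n. x v = block_mean M z v) \<Longrightarrow> cmod (P z - F x) \<le> e / 2"
      and Q: "Q \<in> multiaffine_polys (n * M) d"
      "\<And>z x. (\<forall>i<n * M. cmod (z i) \<le> 1) \<Longrightarrow> (\<forall>v<n. x v = block_mean M z v) \<Longrightarrow> cmod (Q z - G x) \<le> e / 2"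
      by blast
    show ?case
    proof (intro bexI[OF _ multiaffine_polys_add[OF P(1) Q(1)]] allI impI)
      fix z x assume z: "\<forall>i<n * M. cmod (z i) \<le> 1" "\<forall>v<n. x v = block_mean M z v"
      have "cmod (P z + Q z - (F x + G x)) \<le> cmod (P z - F x) + cmod (Q z - G x)"
        by (metis add_diff_add norm_triangle_ineq)
      then show "cmod (P z + Q z - (F x + G x)) \<le> e"
        using P(2)[OF z] Q(2)[OF z] by linarith
    qed
  qed
qed

lemma approximable_cmult:
  assumes "approximable n d F"
  shows "approximable n d (\<lambda>x. a * F x)"
  unfolding approximable_def
proof (intro allI impI)
  fix e :: real assume e: "e > 0"
  then have "e / (cmod a + 1) > 0" by (simp add: add_nonneg_pos)
  with assms have
    "\<forall>\<^sub>F M in sequentially. \<exists>Q\<in>multiaffine_polys (n * M) d.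
     \<forall>z x. (\<forall>i<n * M. cmod (z i) \<le> 1) \<longrightarrow> (\<forall>v<n. x v = block_mean M z v) \<longrightarrow> cmod (Q z - F x) \<le> e / (cmod a + 1)"
    unfolding approximable_def by blast
  then show "\<forall>\<^sub>F M in sequentially. \<exists>Q\<in>multiaffine_polys (n * M) d.
     \<forall>z x. (\<forall>i<n * M. cmod (z i) \<le> 1) \<longrightarrow> (\<forall>v<n. x v = block_mean M z v) \<longrightarrow> cmod (Q z - a * F x) \<le> e"
  proof eventually_elim
    case (elim M)
    then obtain Q where Q: "Q \<in> multiaffine_polys (n * M) d"
      "\<And>z x. (\<forall>i<n * M. cmod (z i) \<le> 1) \<Longrightarrow> (\<forall>v<n. x v = block_mean M z v) \<Longrightarrow> cmod (Q z - F x) \<le> e / (cmod a + 1)"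
      by blast
    show ?case
    proof (intro bexI[OF _ multiaffine_polys_cmult[OF Q(1), of a]] allI impI)
      fix z x assume z: "\<forall>i<n * M. cmod (z i) \<le> 1" "\<forall>v<n. x v = block_mean M z v"
      have "cmod (a * Q z - a * F x) = cmod a * cmod (Q z - F x)"
        by (simp flip: norm_mult right_diff_distrib)
      also have "\<dots> \<le> (cmod a + 1) * (e / (cmod a + 1))"
        using Q(2)[OF z] e by (intro mult_mono) auto
      also have "\<dots> = e" by (simp add: add_nonneg_eq_0_iff)
      finally show "cmod (a * Q z - a * F x) \<le> e" .
    qed
  qed
qed

lemma approximable_sum:
  assumes "\<And>i. i \<in> I \<Longrightarrow> approximable n d (F i)"
  shows "approximable n d (\<lambda>x. \<Sum>i\<in>I. F i x)"
  using assms
  by (induction I rule: infinite_finite_induct) (auto intro: approximable_0 approximable_add)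

text \<open>Expand the product of block means into a sum over all index choices \<open>f\<close> and
  keep the injective ones, whose monomials are squarefree. Each discarded term has modulus at most
  1, and the discarded share \<open>1 - (\<Prod>i<m. (1 - i / M))\<close> tends to 0.\<close>

lemma approximable_monomial:
  assumes m: "m \<le> d" and L: "\<And>t. t < m \<Longrightarrow> L t < n"
  shows "approximable n d (\<lambda>x. \<Prod>t<m. x (L t))"
  unfolding approximable_def
proof (intro allI impI)
  fix e :: real assume e: "e > 0"
  have "(\<lambda>M. \<Prod>i<m. (1 - real i / real M)) \<longlonglongrightarrow> (\<Prod>i<m. (1 - 0))"
    by (intro tendsto_prod tendsto_diff tendsto_const lim_const_over_n)
  then have "(\<lambda>M. 1 - (\<Prod>i<m. (1 - real i / real M))) \<longlonglongrightarrow> 0"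
    using tendsto_diff[OF tendsto_const[of 1]] by force
  then have "\<forall>\<^sub>F M in sequentially. 1 - (\<Prod>i<m. (1 - real i / real M)) < e"
    using e by (rule order_tendstoD)
  then show "\<forall>\<^sub>F M in sequentially. \<exists>Q\<in>multiaffine_polys (n * M) d.
     \<forall>z x. (\<forall>i<n * M. cmod (z i) \<le> 1) \<longrightarrow> (\<forall>v<n. x v = block_mean M z v) \<longrightarrow> cmod (Q z - (\<Prod>t<m. x (L t))) \<le> e"
    using eventually_gt_at_top[of m]
  proof eventually_elim
    case (elim M)
    define A where "A = {..<m} \<rightarrow>\<^sub>E {..<M}"
    define I where "I = {f \<in> A. inj_on f {..<m}}"
    have finA: "finite A" unfolding A_def by (intro finite_PiE) auto
    have cardA: "card A = M ^ m" unfolding A_def by (simp add: card_funcsetE)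
    have cardI: "real (card I) = real M ^ m * (\<Prod>i<m. (1 - real i / real M))"
    proof -
      have "card I = (\<Prod>i<m. M - i)"
        unfolding I_def A_def using card_inj_on_subset_funcset[of "{..<m}" "{..<M}" "{..<m}"]
        by (simp add: atLeast0LessThan)
      also have "real \<dots> = (\<Prod>i<m. real M * (1 - real i / real M))"
        unfolding of_nat_prod using elim(2) by (intro prod.cong) (auto simp: field_simps of_nat_diff)
      finally show ?thesis by (simp add: prod.distrib)
    qed
    define G where "G = (\<lambda>f (z :: nat \<Rightarrow> complex). \<Prod>t<m. z (L t * M + f t))"
    have idx: "L t * M + f t < n * M" if "f \<in> A" "t < m" for f t
    proof -
      have "L t * M + f t < (L t + 1) * M" using that by (auto simp: A_def PiE_iff)
      also have "\<dots> \<le> n * M" using L[OF that(2)] by (intro mult_right_mono) auto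
      finally show ?thesis .
    qed
    define Q where "Q = (\<lambda>z. (1 / of_nat (M ^ m)) * (\<Sum>f\<in>I. G f z))"
    have "G f \<in> multiaffine_polys (n * M) d" if f: "f \<in> I" for f
    proof -
      have f': "f t < M" if "t < m" for t using f that by (auto simp: I_def A_def PiE_iff)
      have inj: "inj_on (\<lambda>t. L t * M + f t) {..<m}"
      proof (rule inj_onI)
        fix s t assume st: "s \<in> {..<m}" "t \<in> {..<m}" "L s * M + f s = L t * M + f t"
        \<comment> \<open>Reduction modulo \<open>M\<close> recovers \<open>f\<close> even when
          \<open>L s = L t\<close>, and \<open>f\<close> is injective.\<close>
        have "f u = (L u * M + f u) mod M" if "u < m" for u using f'[OF that] by simp
        then have "f s = f t" using st by (metis lessThan_iff)
        then show "s = t" using f st by (auto simp: I_def inj_on_def)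
      qed
      have "G f = (\<lambda>z. \<Prod>i\<in>(\<lambda>t. L t * M + f t) ` {..<m}. z i)"
        unfolding G_def prod.reindex[OF inj] by (simp add: o_def)
      moreover have "(\<lambda>t. L t * M + f t) ` {..<m} \<subseteq> {..<n * M}"
        using idx f by (auto simp: I_def)
      moreover have "card ((\<lambda>t. L t * M + f t) ` {..<m}) \<le> d"
        using m by (simp add: card_image[OF inj])
      ultimately show ?thesis by (simp add: multiaffine_polys_prod)
    qed
    then have Q: "Q \<in> multiaffine_polys (n * M) d"
      unfolding Q_def by (intro multiaffine_polys_cmult multiaffine_polys_sum)
    show ?case
    proof (intro bexI[OF _ Q] allI impI)
      fix z x assume z: "\<forall>i<n * M. cmod (z i) \<le> 1" and x: "\<forall>v<n. x v = block_mean M z v"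
      have "(\<Prod>t<m. x (L t)) = (\<Prod>t<m. (\<Sum>j<M. z (L t * M + j)) / of_nat M)"
        using x L by (intro prod.cong) (auto simp: block_mean_def)
      also have "\<dots> = (\<Sum>f\<in>A. G f z) / of_nat (M ^ m)"
        unfolding A_def G_def by (simp add: prod_dividef prod_sum_PiE)
      finally have "Q z - (\<Prod>t<m. x (L t)) = - (\<Sum>f\<in>A - I. G f z) / of_nat (M ^ m)"
        using finA by (subst sum_diff) (auto simp: I_def Q_def diff_divide_distrib)
      then have "cmod (Q z - (\<Prod>t<m. x (L t))) = cmod (\<Sum>f\<in>A - I. G f z) / real M ^ m"
        by (simp add: norm_divide norm_power)
      also have "cmod (\<Sum>f\<in>A - I. G f z) \<le> (\<Sum>f\<in>A - I. 1)"
      proof (intro sum_norm_le)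
        fix f assume "f \<in> A - I"
        then show "cmod (G f z) \<le> 1"
          unfolding G_def prod_norm[symmetric] using idx z by (intro prod_le_1) auto
      qed
      also have "(\<Sum>f\<in>A - I. 1) = real (card A) - real (card I)"
        using finA card_mono[of A I] by (simp add: I_def card_Diff_subset of_nat_diff)
      also have "(real (card A) - real (card I)) / real M ^ m = 1 - (\<Prod>i<m. (1 - real i / real M))"
        using elim(2) by (simp add: cardA cardI diff_divide_distrib)
      finally show "cmod (Q z - (\<Prod>t<m. x (L t))) \<le> e"
        using elim(1) by (simp add: divide_right_mono)
    qed
  qed
qed

lemma approximable_poly_mult:
  assumes d: "degree p + degree q \<le> d" and "v < n" "w < n"
  shows "approximable n d (\<lambda>x. poly p (x v) * poly q (x w))"
proof -
  have "approximable n d (\<lambda>x. x v ^ i * x w ^ j)" if "i + j \<le> d" for i j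
  proof -
    have "approximable n d (\<lambda>x. \<Prod>t<i + j. x (if t < i then v else w))"
      using assms that by (intro approximable_monomial) auto
    moreover have "(\<Prod>t<i + j. x (if t < i then v else w)) = x v ^ i * x w ^ j" for x :: "nat \<Rightarrow> complex"
    proof -
      have "{..<i + j} = {..<i} \<union> {i..<i + j}" by auto
      then have "(\<Prod>t<i + j. x (if t < i then v else w)) =
         (\<Prod>t<i. x (if t < i then v else w)) * (\<Prod>t=i..<i + j. x (if t < i then v else w))"
        by (metis finite_atLeastLessThan finite_lessThan ivl_disj_int_one(2) prod.union_disjoint)
      also have "(\<Prod>t=i..<i + j. x (if t < i then v else w)) = (\<Prod>t=i..<i + j. x w)"
        by (intro prod.cong) auto
      finally show ?thesis by simp
    qed
    ultimately show ?thesis by simp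
  qed
  then have "approximable n d (\<lambda>x. \<Sum>i\<le>degree p. \<Sum>j\<le>degree q. (coeff p i * coeff q j) * (x v ^ i * x w ^ j))"
    using d by (intro approximable_sum approximable_cmult) auto
  then show ?thesis
    by (simp add: poly_altdef sum_product mult_ac)
qed

lemma approximable_poly:
  assumes "degree p \<le> d" "v < n"
  shows "approximable n d (\<lambda>x. poly p (x v))"
  using approximable_poly_mult[of p 1 d v n v] assms by simp

section \<open>Transfer from polynomials on the cube to \<open>C2\<close>\<close>

text \<open>Block means of signs lie in \<open>[-1, 1]\<close>, where \<open>bound\<close> applies,
  whereas repeating \<open>\<zeta>\<close> along the blocks reproduces \<open>\<zeta>\<close> as
  block means. An approximant with error \<open>e\<close> gives the quotient
  \<open>(V - e) / (B + e)\<close>; then \<open>e\<close> tends to 0.\<close>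

lemma C2_lower_approximable:
  assumes F: "approximable n d F" and n: "n > 0"
    and bound: "\<And>x. (\<And>v. v < n \<Longrightarrow> x v \<in> of_real ` {-1..1}) \<Longrightarrow> cmod (F x) \<le> B" and B: "B > 0"
    and \<zeta>: "\<And>v. v < n \<Longrightarrow> cmod (\<zeta> v) = 1" and V: "cmod (F \<zeta>) \<ge> V" "V > 0"
  shows "ereal (V / B) \<le> C2 d"
proof -
  have le: "ereal ((V - e) / (B + e)) \<le> C2 d" if e: "e > 0" "e < V" for e
  proof -
    have "\<forall>\<^sub>F M in sequentially. \<exists>Q\<in>multiaffine_polys (n * M) d.
     \<forall>z x. (\<forall>i<n * M. cmod (z i) \<le> 1) \<longrightarrow> (\<forall>v<n. x v = block_mean M z v) \<longrightarrow> cmod (Q z - F x) \<le> e"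
      using F e by (auto simp: approximable_def)
    then have "\<forall>\<^sub>F M in sequentially. (\<exists>Q\<in>multiaffine_polys (n * M) d.
     \<forall>z x. (\<forall>i<n * M. cmod (z i) \<le> 1) \<longrightarrow> (\<forall>v<n. x v = block_mean M z v) \<longrightarrow> cmod (Q z - F x) \<le> e) \<and> M > d"
      using eventually_gt_at_top[of d] by eventually_elim auto
    then obtain M Q where M: "M > d" and Q: "Q \<in> multiaffine_polys (n * M) d"
      and Qe: "\<And>z x. (\<forall>i<n * M. cmod (z i) \<le> 1) \<Longrightarrow> (\<forall>v<n. x v = block_mean M z v) \<Longrightarrow> cmod (Q z - F x) \<le> e"
      by (auto simp: eventually_sequentially)
    have idx: "v * M + j < n * M" if "v < n" "j < M" for v j
    proof -
      have "v * M + j < (v + 1) * M" using that by auto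
      also have "\<dots> \<le> n * M" using that by (intro mult_right_mono) auto
      finally show ?thesis .
    qed
    show ?thesis
    proof (rule C2_lower[OF Q])
      have "1 * M \<le> n * M" using n by (intro mult_right_mono) auto
      then show "d \<le> n * M" using M by linarith
      show "B + e > 0" "V - e > 0" using B e by auto
      fix z assume z: "z \<in> hypercube (n * M)"
      have z': "z i = -1 \<or> z i = 1" if "i < n * M" for i
        using z that by (auto simp: hypercube_def PiE_iff)
      have "cmod (Q z - F (block_mean M z)) \<le> e"
        using z' by (intro Qe) force+
      moreover have "cmod (F (block_mean M z)) \<le> B"
      proof (rule bound)
        fix v assume v: "v < n"
        define r where "r = (\<Sum>j<M. Re (z (v * M + j))) / real M"
        have zr: "z (v * M + j) = of_real (Re (z (v * M + j)))" "\<bar>Re (z (v * M + j))\<bar> \<le> 1" if "j < M" for j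
          using z'[OF idx[OF v that]] by auto
        have "block_mean M z v = of_real r"
          unfolding block_mean_def r_def using zr(1) by (simp cong: sum.cong_simp)
        moreover have "\<bar>\<Sum>j<M. Re (z (v * M + j))\<bar> \<le> (\<Sum>j<M. 1)"
          using zr(2) by (intro order.trans[OF sum_abs] sum_mono) auto
        then have "\<bar>r\<bar> \<le> 1" unfolding r_def using M by (simp add: field_simps)
        ultimately show "block_mean M z v \<in> of_real ` {-1..1}"
          by (intro image_eqI[of _ _ r]) auto
      qed
      ultimately show "cmod (Q z) \<le> B + e"
        using norm_triangle_ineq2[of "Q z" "F (block_mean M z)"] by linarith
    next
      define z where "z = restrict (\<lambda>i. \<zeta> (i div M)) {..<n * M}"
      have z1: "cmod (z i) = 1" if "i < n * M" for i
        using that \<zeta>[of "i div M"] M by (simp add: z_def less_mult_imp_div_less)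
      then show "z \<in> torus (n * M)" by (auto simp: torus_def z_def)
      have "\<zeta> v = block_mean M z v" if v: "v < n" for v
      proof -
        have "block_mean M z v = (\<Sum>j<M. \<zeta> v) / of_nat M"
          unfolding block_mean_def using idx[OF v] by (intro arg_cong2[of _ _ _ _ "(/)"] sum.cong) (auto simp: z_def)
        then show ?thesis using M by simp
      qed
      then have "cmod (Q z - F \<zeta>) \<le> e"
        using z1 by (intro Qe) auto
      then show "V - e \<le> cmod (Q z)"
        using norm_triangle_ineq2[of "F \<zeta>" "Q z"] V by (simp add: norm_minus_commute)
    qed
  qed
  have "((\<lambda>e. ereal ((V - e) / (B + e))) \<longlongrightarrow> ereal ((V - 0) / (B + 0))) (at_right 0)"
    using B by (intro tendsto_intros) auto
  then have "((\<lambda>e. ereal ((V - e) / (B + e))) \<longlongrightarrow> ereal (V / B)) (at_right 0)" by simp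
  moreover have "\<forall>\<^sub>F e in at_right 0. ereal ((V - e) / (B + e)) \<le> C2 d"
    using eventually_at_right_less[of "0::real"] eventually_at_right_real[OF V(2)]
    by eventually_elim (auto intro: le)
  ultimately show ?thesis by (rule tendsto_upperbound) auto
qed

section \<open>Chebyshev polynomials and equidistributed phases\<close>

fun cheb :: "nat \<Rightarrow> complex poly" where
  "cheb 0 = 1"
| "cheb (Suc 0) = [:0, 1:]"
| "cheb (Suc (Suc n)) = [:0, 2:] * cheb (Suc n) - cheb n"

lemma degree_cheb: "degree (cheb n) \<le> n"
proof (induction n rule: cheb.induct)
  case (3 n)
  have "degree ([:0, 2:] * cheb (Suc n)) \<le> 1 + Suc n"
    using degree_mult_le[of "[:0, 2:]" "cheb (Suc n)"] 3 by simp
  then show ?case using 3 by (auto intro!: degree_diff_le)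
qed auto

lemma cheb_joukowski:
  assumes "w \<noteq> 0"
  shows "poly (cheb n) ((w + 1 / w) / 2) = (w ^ n + (1 / w) ^ n) / 2"
proof (induction n rule: cheb.induct)
  case (3 n)
  have "poly (cheb (Suc (Suc n))) ((w + 1 / w) / 2) =
        (w + 1 / w) * ((w ^ Suc n + (1 / w) ^ Suc n) / 2) - (w ^ n + (1 / w) ^ n) / 2"
    using 3 by (simp only: cheb.simps poly_diff poly_mult) simp
  also have "\<dots> = (w ^ Suc (Suc n) + (1 / w) ^ Suc (Suc n)) / 2"
  proof -
    \<comment> \<open>For \<open>v = 1 / w\<close> the last summand vanishes, which leaves the
      Chebyshev recurrence for sums of powers.\<close>
    have "(w + v) * ((w * a + v * b) / 2) - (a + b) / 2 =
          (w * (w * a) + v * (v * b) + (w * v - 1) * (a + b)) / 2" for v a b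
      by (simp add: algebra_simps add_divide_distrib diff_divide_distrib)
    from this[of "1 / w" "w ^ n" "(1 / w) ^ n"] show ?thesis using assms by (simp only: power_Suc) simp
  qed
  finally show ?case .
qed auto

lemma cheb_cos: "poly (cheb n) (of_real (cos t)) = of_real (cos (real n * t))"
proof -
  have cis: "(cis x + 1 / cis x) / 2 = of_real (cos x)" for x
    using cis_inverse[of x] by (simp only: inverse_eq_divide) (simp add: complex_eq_iff)
  have "poly (cheb n) ((cis t + 1 / cis t) / 2) = (cis t ^ n + (1 / cis t) ^ n) / 2"
    by (rule cheb_joukowski) simp
  then show ?thesis using cis[of t] cis[of "real n * t"] by (simp only: power_one_over Complex.DeMoivre)
qed

section \<open>Points of the unit circle with prescribed Chebyshev phase\<close>

text \<open>The Joukowski image of \<open>r * \<i> * cis \<xi>\<close>, where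
  \<open>r = exp (arsinh (cos \<xi>))\<close> is the radius that puts the image on the unit circle.
  At \<open>\<xi> = 0\<close> the point is \<open>\<i>\<close> and
  \<open>r = 1 + sqrt 2\<close>.\<close>

definition torus_pt :: "real \<Rightarrow> complex" where
  "torus_pt \<xi> = (let w = of_real (exp (arsinh (cos \<xi>))) * (\<i> * cis \<xi>) in (w + 1 / w) / 2)"

lemma cmod_torus_pt: "cmod (torus_pt \<xi>) = 1"
proof -
  define r where "r = exp (arsinh (cos \<xi>))"
  have r: "r > 0" by (simp add: r_def)
  have s: "(r - 1 / r) / 2 = cos \<xi>"
    using sinh_arsinh_real[of "cos \<xi>"] by (simp add: sinh_def r_def exp_minus field_simps)
  have c: "(r + 1 / r) / 2 = sqrt ((cos \<xi>)\<^sup>2 + 1)"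
    using cosh_arsinh_real[of "cos \<xi>"] by (simp add: cosh_def r_def exp_minus field_simps)
  have "1 / (of_real r * (\<i> * cis \<xi>)) = - (of_real (1 / r) * (\<i> * cis (- \<xi>)))"
    using r by (simp add: field_simps flip: cis_inverse)
  then have "torus_pt \<xi> = (of_real r * (\<i> * cis \<xi>) - of_real (1 / r) * (\<i> * cis (- \<xi>))) / 2"
    by (simp add: torus_pt_def r_def Let_def)
  also have "\<dots> = Complex (- ((r + 1 / r) / 2 * sin \<xi>)) ((r - 1 / r) / 2 * cos \<xi>)"
    by (simp add: complex_eq_iff algebra_simps add_divide_distrib diff_divide_distrib)
  finally have "(cmod (torus_pt \<xi>))\<^sup>2 = ((cos \<xi>)\<^sup>2 + 1) * (sin \<xi>)\<^sup>2 + (cos \<xi>)\<^sup>2 * (cos \<xi>)\<^sup>2"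
    unfolding s c by (simp add: cmod_power2 power_mult_distrib)
  also have "\<dots> = 1" using sin_cos_squared_add[of \<xi>] by algebra
  finally show ?thesis by (simp add: power2_eq_1_iff) (smt (verit) norm_ge_zero)
qed

text \<open>The value is half the sum of the \<open>n\<close>-th powers of \<open>w\<close> and
  \<open>1 / w\<close>. The first grows with known phase; the second, up to \<open>\<i> ^ n\<close>,
  is \<open>\<eta>\<close>, a small error as long as \<open>cos \<xi> > 0\<close>.\<close>

lemma cheb_torus_pt:
  obtains \<eta> where "cmod \<eta> = exp (- real n * arsinh (cos \<xi>))"
    "poly (cheb n) (torus_pt \<xi>) = \<i> ^ n * (of_real (exp (real n * arsinh (cos \<xi>))) * cis (real n * \<xi>) + \<eta>) / 2"
proof
  define r where "r = exp (arsinh (cos \<xi>))"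
  define \<eta> where "\<eta> = (1 / (of_real r * (\<i> * cis \<xi>))) ^ n / \<i> ^ n"
  have rn: "r ^ n = exp (real n * arsinh (cos \<xi>))"
    by (simp add: r_def exp_of_nat_mult)
  show "cmod \<eta> = exp (- real n * arsinh (cos \<xi>))"
    by (simp add: \<eta>_def norm_divide norm_power norm_mult exp_minus inverse_eq_divide power_one_over
      flip: rn) (simp add: r_def)
  have "poly (cheb n) (torus_pt \<xi>) = ((of_real r * (\<i> * cis \<xi>)) ^ n + (1 / (of_real r * (\<i> * cis \<xi>))) ^ n) / 2"
    unfolding torus_pt_def Let_def r_def[symmetric] by (rule cheb_joukowski) (simp add: r_def)
  also have "\<dots> = (of_real (r ^ n) * (\<i> ^ n * cis (real n * \<xi>)) + \<i> ^ n * \<eta>) / 2"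
    by (simp add: \<eta>_def power_mult_distrib Complex.DeMoivre)
  finally show "poly (cheb n) (torus_pt \<xi>) =
      \<i> ^ n * (of_real (exp (real n * arsinh (cos \<xi>))) * cis (real n * \<xi>) + \<eta>) / 2"
    by (simp add: rn algebra_simps)
qed

section \<open>Averages over equidistributed phases\<close>

text \<open>The midpoints of \<open>J\<close> equal subintervals of
  \<open>[-pi / 2, pi / 2]\<close>. A half turn suffices because the modulus of the cosine has
  period \<open>pi\<close>.\<close>

definition phase :: "nat \<Rightarrow> nat \<Rightarrow> real" where
  "phase J j = - (pi / 2) + (real j + 1 / 2) * (pi / real J)"

lemma abs_phase_le:
  assumes "j < J"
  shows "\<bar>phase J j\<bar> \<le> pi / 2"
proof -
  have "(real j + 1 / 2) * (pi / real J) \<le> real J * (pi / real J)"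
    using assms by (intro mult_right_mono) auto
  moreover have "(real j + 1 / 2) * (pi / real J) \<ge> 0" by simp
  moreover have "real J * (pi / real J) = pi" using assms by simp
  ultimately show ?thesis unfolding phase_def by linarith
qed

text \<open>\<open>pi\<^sup>2 / 12\<close> is the mean of \<open>s\<^sup>2\<close> over
  \<open>[-pi / 2, pi / 2]\<close>, and the midpoint rule stays below it.\<close>

lemma sum_phase_square_le:
  assumes "J > 0"
  shows "(\<Sum>j<J. (phase J j)\<^sup>2) \<le> real J * (pi\<^sup>2 / 12)"
proof -
  \<comment> \<open>A free \<open>c\<close> lets the induction run over \<open>n\<close> alone;
    afterwards both are taken to be \<open>J\<close>.\<close>
  have sq: "(\<Sum>j<n. (2 * real j + 1 - c)\<^sup>2) = real n * (4 * (real n)\<^sup>2 - 1) / 3 - 2 * c * (real n)\<^sup>2 + real n * c\<^sup>2"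
    for n and c :: real
    by (induction n) (simp_all add: field_simps power2_eq_square)
  have "phase J j = pi / (2 * real J) * (2 * real j + 1 - real J)" for j
    using assms by (simp add: phase_def field_simps)
  then have "(\<Sum>j<J. (phase J j)\<^sup>2) = (pi / (2 * real J))\<^sup>2 * (\<Sum>j<J. (2 * real j + 1 - real J)\<^sup>2)"
    by (simp only: power_mult_distrib sum_distrib_left)
  also have "\<dots> = (pi / (2 * real J))\<^sup>2 * (((real J) ^ 3 - real J) / 3)"
    unfolding sq by (simp add: field_simps power2_eq_square power3_eq_cube)
  also have "\<dots> \<le> (pi / (2 * real J))\<^sup>2 * ((real J) ^ 3 / 3)"
    by (intro mult_left_mono) auto
  also have "\<dots> = real J * (pi\<^sup>2 / 12)"
    using assms by (simp add: field_simps power2_eq_square power3_eq_cube)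
  finally show ?thesis .
qed

text \<open>Multiplied by \<open>2 * sin (h / 2)\<close>, each cosine is a difference of consecutive
  sines, so the sum telescopes.\<close>

lemma sum_cos_progression:
  "2 * sin (h / 2) * (\<Sum>j<J. cos (\<psi> + real j * h)) = sin (\<psi> + real J * h - h / 2) - sin (\<psi> - h / 2)"
proof (induction J)
  case (Suc J)
  have "2 * sin (h / 2) * cos (\<psi> + real J * h) =
        sin (\<psi> + real (Suc J) * h - h / 2) - sin (\<psi> + real J * h - h / 2)"
    using sin_plus_sin[of "\<psi> + real J * h + h / 2" "- (\<psi> + real J * h - h / 2)"] sin_times_cos[of "h / 2" "\<psi> + real J * h"]
      sin_minus[of "\<psi> + real J * h - h / 2"]
    by (simp add: algebra_simps)
  then show ?case using Suc by (simp add: algebra_simps)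
qed simp

text \<open>The sum is \<open>pi / J\<close>-periodic in \<open>\<psi>\<close>, so that all the angles may be moved into \<open>[-pi / 2, pi / 2]\<close>.\<close>

lemma sum_abs_cos_le:
  assumes J: "J > 0"
  shows "(\<Sum>j<J. \<bar>cos (\<psi> + phase J j)\<bar>) \<le> 1 / sin (pi / (2 * real J))"
proof -
  define h where "h = pi / real J"
  have h: "h > 0" and Jh: "real J * h = pi" using J by (auto simp: h_def)
  define f where "f = (\<lambda>\<psi>::real. \<Sum>j<J. \<bar>cos (\<psi> + real j * h)\<bar>)"
  have per1: "f (\<psi> + h) = f \<psi>" for \<psi>
  proof -
    have "f (\<psi> + h) = (\<Sum>j<J. \<bar>cos (\<psi> + real (Suc j) * h)\<bar>)"
      by (simp add: f_def algebra_simps)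
    also have "\<dots> = (\<Sum>j<Suc J. \<bar>cos (\<psi> + real j * h)\<bar>) - \<bar>cos \<psi>\<bar>"
      by (subst sum.lessThan_Suc_shift) simp
    also have "\<dots> = f \<psi>"
      by (simp add: f_def Jh)
    finally show ?thesis .
  qed
  have pern: "f (\<psi> + real n * h) = f \<psi>" for n \<psi>
  proof (induction n)
    case (Suc n)
    then show ?case using per1[of "\<psi> + real n * h"] by (simp add: algebra_simps)
  qed simp
  have bound: "f \<psi> \<le> 1 / sin (h / 2)" if \<psi>: "- (pi / 2) \<le> \<psi>" "\<psi> \<le> - (pi / 2) + h" for \<psi> :: real
  proof -
    have "f \<psi> = (\<Sum>j<J. cos (\<psi> + real j * h))"
      unfolding f_def
    proof (intro sum.cong refl abs_of_nonneg cos_ge_zero)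
      fix j assume "j \<in> {..<J}"
      then have "(real j + 1) * h \<le> real J * h" using h by (intro mult_right_mono) auto
      then show "\<psi> + real j * h \<le> pi / 2" using \<psi> Jh by (simp add: algebra_simps)
      have "0 \<le> real j * h" using h by simp
      then show "- (pi / 2) \<le> \<psi> + real j * h" using \<psi> by linarith
    qed
    then have "2 * sin (h / 2) * f \<psi> = 2 * sin (h / 2) * (\<Sum>j<J. cos (\<psi> + real j * h))"
      by (rule arg_cong)
    then have "2 * sin (h / 2) * f \<psi> \<le> 2"
      using sum_cos_progression[of h \<psi> J] sin_le_one[of "\<psi> + real J * h - h / 2"]
        sin_ge_minus_one[of "\<psi> - h / 2"] by linarith
    moreover have "h \<le> pi" using J by (simp add: h_def divide_le_eq)
    then have "sin (h / 2) > 0" using h by (intro sin_gt_zero) auto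
    ultimately show ?thesis by (simp add: field_simps)
  qed
  \<comment> \<open>\<open>\<phi>\<close> absorbs the offset of \<open>phase\<close>, so that the
    angles are \<open>\<phi> + j * h\<close>. Subtracting \<open>m * h\<close> moves it into the
    window of length \<open>h\<close> above \<open>- (pi / 2)\<close> where \<open>bound\<close>
    applies.\<close>
  define \<phi> where "\<phi> = \<psi> - pi / 2 + h / 2"
  define m where "m = \<lfloor>(\<phi> + pi / 2) / h\<rfloor>"
  have "of_int m \<le> (\<phi> + pi / 2) / h" "(\<phi> + pi / 2) / h < of_int m + 1"
    unfolding m_def by linarith+
  then have "f (\<phi> - of_int m * h) \<le> 1 / sin (h / 2)"
    using h by (intro bound) (auto simp: field_simps)
  moreover have "f (\<phi> - of_int m * h) = f \<phi>"
  proof (cases "m \<ge> 0")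
    case True
    then show ?thesis using pern[of "\<phi> - of_int m * h" "nat m"] by simp
  next
    case False
    then show ?thesis using pern[of "\<phi>" "nat (-m)"] by simp
  qed
  moreover have "f \<phi> = (\<Sum>j<J. \<bar>cos (\<psi> + phase J j)\<bar>)"
    by (simp add: f_def \<phi>_def phase_def h_def algebra_simps)
  ultimately show ?thesis by (simp add: h_def mult.commute)
qed

lemma sin_half_step_tendsto: "(\<lambda>J. real J * sin (pi / (2 * real J))) \<longlonglongrightarrow> pi / 2"
  by real_asymp

lemma sin_half_step_pos: "J > 0 \<Longrightarrow> sin (pi / (2 * real J)) > 0"
  by (intro sin_gt_zero) (auto simp: field_simps)

section \<open>Quadratic lower bounds for the cosine and for the growth rate
  \<open>arsinh (cos x)\<close>\<close>

lemma one_minus_square_le_cos: "1 - x\<^sup>2 / 2 \<le> cos (x::real)"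
proof -
  have "(sin (x / 2))\<^sup>2 \<le> (x / 2)\<^sup>2"
    using abs_sin_x_le_abs_x[of "x / 2"] by (simp only: abs_le_square_iff)
  then show ?thesis using cos_double_sin[of "x / 2"] by (simp add: power_divide)
qed

text \<open>The function \<open>arsinh (cos t) + c * t\<^sup>2\<close> increases on
  \<open>[0, b]\<close>: assumption \<open>le\<close> is the squared form of the sign condition on
  its derivative, with \<open>(cos t)\<^sup>2 + 1\<close> written as
  \<open>2 - (sin t)\<^sup>2\<close>. Evenness covers negative \<open>x\<close>.\<close>

lemma arsinh_cos_ge:
  assumes x: "\<bar>x\<bar> \<le> b" and b: "b \<le> pi" and c: "c \<ge> 0"
    and le: "\<And>t. 0 \<le> t \<Longrightarrow> t \<le> b \<Longrightarrow> (sin t)\<^sup>2 * (1 + 4 * c\<^sup>2 * t\<^sup>2) \<le> 8 * c\<^sup>2 * t\<^sup>2"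
  shows "arsinh (cos x) \<ge> arsinh 1 - c * x\<^sup>2"
proof -
  define f where "f = (\<lambda>t. arsinh (cos t) + c * t\<^sup>2)"
  have "f 0 \<le> f \<bar>x\<bar>"
  proof (rule DERIV_nonneg_imp_nondecreasing[where f = f])
    fix t assume t: "0 \<le> t" "t \<le> \<bar>x\<bar>"
    have "((\<lambda>t. arsinh (cos t) + c * t\<^sup>2) has_real_derivative (2 * c * t - sin t / sqrt ((cos t)\<^sup>2 + 1))) (at t)"
      by (auto intro!: derivative_eq_intros DERIV_chain2[OF arsinh_real_has_field_derivative])
    moreover have "sin t \<le> 2 * c * t * sqrt ((cos t)\<^sup>2 + 1)"
    proof (rule power2_le_imp_le)
      have "(sqrt ((cos t)\<^sup>2 + 1))\<^sup>2 = (cos t)\<^sup>2 + 1" by simp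
      also have "\<dots> = 2 - (sin t)\<^sup>2" by (simp add: cos_squared_eq)
      finally show "(sin t)\<^sup>2 \<le> (2 * c * t * sqrt ((cos t)\<^sup>2 + 1))\<^sup>2"
        using le[of t] t x by (simp only: power_mult_distrib) (simp add: algebra_simps)
    qed (use t c in auto)
    then have "2 * c * t - sin t / sqrt ((cos t)\<^sup>2 + 1) \<ge> 0"
      by (simp add: divide_le_eq add_nonneg_pos)
    ultimately show "\<exists>y. (f has_real_derivative y) (at t) \<and> 0 \<le> y"
      unfolding f_def by blast
  qed simp
  then show ?thesis by (cases "x \<ge> 0") (simp_all add: f_def)
qed

text \<open>Near 0 the criterion requires \<open>c \<ge> 1 / sqrt 8\<close>, about 0.3536. The crude
  \<open>sin t \<le> t\<close> gives 0.382 up to 53 / 100, just beyond \<open>pi / 6\<close>, the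
  largest angle that occurs in degree 3.\<close>

lemma arsinh_cos_ge_coarse:
  assumes "\<bar>x :: real\<bar> \<le> 53 / 100"
  shows "arsinh (cos x) \<ge> arsinh 1 - (382 / 1000) * x\<^sup>2"
proof (rule arsinh_cos_ge[OF assms])
  fix t :: real assume t: "0 \<le> t" "t \<le> 53 / 100"
  have s: "(sin t)\<^sup>2 \<le> t\<^sup>2"
    using abs_sin_x_le_abs_x[of t] by (simp add: abs_le_square_iff)
  have "t\<^sup>2 \<le> (53 / 100)\<^sup>2" using t by (intro power_mono)
  then have "1 + 4 * (382 / 1000)\<^sup>2 * t\<^sup>2 \<le> 8 * (382 / 1000)\<^sup>2" by (simp add: power2_eq_square)
  then have "t\<^sup>2 * (1 + 4 * (382 / 1000)\<^sup>2 * t\<^sup>2) \<le> t\<^sup>2 * (8 * (382 / 1000)\<^sup>2)" by (intro mult_left_mono) auto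
  moreover have "(sin t)\<^sup>2 * (1 + 4 * (382 / 1000)\<^sup>2 * t\<^sup>2) \<le> t\<^sup>2 * (1 + 4 * (382 / 1000)\<^sup>2 * t\<^sup>2)"
    using s by (intro mult_right_mono) auto
  ultimately show "(sin t)\<^sup>2 * (1 + 4 * (382 / 1000)\<^sup>2 * t\<^sup>2) \<le> 8 * (382 / 1000)\<^sup>2 * t\<^sup>2" by (simp add: mult.commute)
qed (use pi_gt3 in auto)

text \<open>For degrees from 11 on, the angles are at most \<open>pi / 11 < 3 / 10\<close>. There
  the Taylor bound \<open>sin t \<le> t * (1 - t\<^sup>2 / 7)\<close> allows a constant close to the
  optimal \<open>1 / sqrt 8\<close>.\<close>

lemma arsinh_cos_ge_fine:
  assumes "\<bar>x :: real\<bar> \<le> 3 / 10"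
  shows "arsinh (cos x) \<ge> arsinh 1 - (357 / 1000) * x\<^sup>2"
proof (rule arsinh_cos_ge[OF assms])
  fix t :: real assume t: "0 \<le> t" "t \<le> 3 / 10"
  define u where "u = t\<^sup>2"
  have u: "0 \<le> u" "u \<le> 9 / 100" using power_mono[OF t(2,1), of 2] by (auto simp: u_def power2_eq_square)
  have "\<bar>sin t - (\<Sum>m<5. sin_coeff m * t ^ m)\<bar> \<le> inverse (fact 5) * \<bar>t\<bar> ^ 5"
    by (rule Maclaurin_sin_bound)
  moreover have "(\<Sum>m<5. sin_coeff m * t ^ m) = t - t ^ 3 / 6"
  proof -
    have "{..<5} = {0, 1, 2, 3, 4::nat}" by auto
    then show ?thesis by (simp add: sin_coeff_def fact_numeral)
  qed
  moreover have "inverse (fact 5) * \<bar>t\<bar> ^ 5 = t ^ 5 / 120"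
    using t by (simp add: fact_numeral)
  ultimately have "sin t \<le> t - t ^ 3 / 6 + t ^ 5 / 120" by linarith
  also have "\<dots> = t * (1 - u / 6 + u\<^sup>2 / 120)"
    by (simp add: u_def algebra_simps eval_nat_numeral)
  \<comment> \<open>The constant is \<open>1 / 42 = 1 / 6 - 1 / 7\<close>.\<close>
  also have "u\<^sup>2 / 120 \<le> u / 42"
    using u mult_left_mono[of u "9/100" u] by (simp add: power2_eq_square)
  then have "t * (1 - u / 6 + u\<^sup>2 / 120) \<le> t * (1 - u / 7)"
    using t by (intro mult_left_mono) auto
  finally have "(sin t)\<^sup>2 \<le> (t * (1 - u / 7))\<^sup>2"
    using t pi_gt3 by (intro power_mono sin_ge_zero) auto
  also have "\<dots> = u * (1 - u / 7)\<^sup>2" by (simp add: u_def power_mult_distrib)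
  finally have "(sin t)\<^sup>2 * (1 + 4 * (357 / 1000)\<^sup>2 * t\<^sup>2) \<le> u * (1 - u / 7)\<^sup>2 * (1 + 4 * (357 / 1000)\<^sup>2 * t\<^sup>2)"
    by (intro mult_right_mono) auto
  also have "\<dots> = u * ((1 - u / 7)\<^sup>2 * (1 + 4 * (357 / 1000)\<^sup>2 * u))" by (simp add: u_def)
  also have "\<dots> \<le> u * (8 * (357 / 1000)\<^sup>2)"
  proof (intro mult_left_mono u)
    have "(1 - u / 7)\<^sup>2 \<le> 1 - 2 * u / 7 + (9 / 100) * u / 49"
      using mult_right_mono[OF u(2,1)] by (simp add: power2_eq_square algebra_simps)
    then have "(1 - u / 7)\<^sup>2 \<le> 1 - (28 / 100) * u" using u by linarith
    then have "(1 - u / 7)\<^sup>2 * (1 + 4 * (357 / 1000)\<^sup>2 * u) \<le> (1 - (28 / 100) * u) * (1 + 4 * (357 / 1000)\<^sup>2 * u)"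
      using u by (intro mult_right_mono) auto
    also have "\<dots> = 1 + 229796 / 1000000 * u - 14274288 / 100000000 * u\<^sup>2"
      by (simp add: power2_eq_square field_simps)
    also have "\<dots> \<le> 1 + (23 / 100) * u - (14 / 100) * u\<^sup>2"
      using u zero_le_power2[of u] by linarith
    also have "\<dots> \<le> 8 * (357 / 1000)\<^sup>2"
    proof -
      \<comment> \<open>The quadratic increases up to \<open>u = 9 / 100\<close>; this product is
        the difference of its values at \<open>9 / 100\<close> and \<open>u\<close>.\<close>
      have "(9/100 - u) * ((23 / 100) - (14 / 100) * (u + 9/100)) \<ge> 0" using u by (intro mult_nonneg_nonneg) auto
      also have "(9/100 - u) * (23 / 100 - 14 / 100 * (u + 9/100)) =
          19566 / 1000000 - 23 / 100 * u + 14 / 100 * u\<^sup>2"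
        by (simp add: power2_eq_square field_simps)
      finally show ?thesis by (simp add: power2_eq_square)
    qed
    finally show "(1 - u / 7)\<^sup>2 * (1 + 4 * (357 / 1000)\<^sup>2 * u) \<le> 8 * (357 / 1000)\<^sup>2" .
  qed
  finally show "(sin t)\<^sup>2 * (1 + 4 * (357 / 1000)\<^sup>2 * t\<^sup>2) \<le> 8 * (357 / 1000)\<^sup>2 * t\<^sup>2" by (simp add: u_def mult_ac)
qed (use pi_gt3 in auto)

lemma arsinh_1: "arsinh 1 = ln (1 + sqrt 2)"
  by (simp add: arsinh_real_def)

lemma exp_arsinh_1: "exp (real n * arsinh 1) = (1 + sqrt 2) ^ n"
proof -
  have "1 + sqrt 2 > 0" by (simp add: add_pos_pos)
  then show ?thesis by (simp add: arsinh_1 exp_of_nat_mult)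
qed

lemma norm_le_of_real_parts:
  assumes "\<And>\<psi>. Re (cis (- \<psi>) * z) \<le> B"
  shows "cmod z \<le> B"
proof -
  have "z = of_real (cmod z) * cis (Arg z)" by (metis rcis_cmod_Arg rcis_def)
  then have "cis (- Arg z) * z = of_real (cmod z)"
    by (metis (no_types, lifting) add.left_inverse cis_mult cis_zero mult.left_commute mult.right_neutral)
  then show ?thesis using assms[of "Arg z"] by simp
qed

section \<open>The lower bound for small degrees\<close>

text \<open>\<open>J\<close> is the number of summands of the test polynomial. The limit replaces
  the factor \<open>J * sin (pi / (2 * J))\<close>, which comes from \<open>sum_abs_cos_le\<close>,
  by \<open>pi / 2\<close>.\<close>

lemma C2_lower_limit:
  assumes "\<And>J. J > 0 \<Longrightarrow> ereal (K * (real J * sin (pi / (2 * real J)))) \<le> C2 d"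
  shows "ereal (K * (pi / 2)) \<le> C2 d"
proof (rule LIMSEQ_le_const2)
  show "(\<lambda>J. ereal (K * (real J * sin (pi / (2 * real J))))) \<longlonglongrightarrow> ereal (K * (pi / 2))"
    by (intro tendsto_intros sin_half_step_tendsto)
  show "\<exists>N. \<forall>n\<ge>N. ereal (K * (real n * sin (pi / (2 * real n)))) \<le> C2 d"
    using assms by (intro exI[of _ 1]) auto
qed

text \<open>As \<open>exp (arsinh 1) = 1 + sqrt 2\<close>, the loss is a factor
  \<open>exp (- x)\<close>, and \<open>exp (- x) \<ge> 1 - x\<close>. The case \<open>l = 0\<close>
  serves a single Chebyshev polynomial.\<close>

lemma exp_growth_ge:
  assumes "g1 \<ge> arsinh 1 - x1" "g2 \<ge> arsinh 1 - x2"
  shows "exp (real k * g1) * exp (real l * g2) \<ge> (1 + sqrt 2) ^ (k + l) * (1 - (real k * x1 + real l * x2))"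
proof -
  have "(1 + sqrt 2) ^ (k + l) * (1 - (real k * x1 + real l * x2)) \<le>
        (1 + sqrt 2) ^ (k + l) * exp (- (real k * x1 + real l * x2))"
    using exp_ge_add_one_self[of "- (real k * x1 + real l * x2)"]
    by (intro mult_left_mono) (simp_all only: diff_conv_add_uminus, simp)
  also have "\<dots> = exp (real (k + l) * arsinh 1 - (real k * x1 + real l * x2))"
    by (simp add: exp_diff exp_minus exp_add divide_inverse flip: exp_arsinh_1)
  also have "\<dots> \<le> exp (real k * g1 + real l * g2)"
    using mult_left_mono[OF assms(1), of "real k"] mult_left_mono[OF assms(2), of "real l"]
    by (simp add: algebra_simps)
  finally show ?thesis by (simp add: exp_add)
qed

lemma cube_pointE:
  assumes "x \<in> complex_of_real ` {-1..1}"
  obtains t where "x = of_real (cos t)"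
  using assms by (metis arccos_cos cos_arccos atLeastAtMost_iff image_iff)

text \<open>
  Small degrees: the phases of \<open>cheb d\<close> at the points \<open>torus_pt (s / d)\<close> cancel the coefficients
  \<open>cis (- s)\<close>, whereas on the cube only \<open>\<Sum> \<bar>cos\<bar>\<close> survives.
\<close>

lemma C2_lower_small:
  assumes d: "d \<ge> 3"
    and K: "K = ((1 + sqrt 2) ^ d * (1 - (382 / 1000) * pi\<^sup>2 / (12 * real d)) - 1) / 2" "K > 0"
  shows "ereal (K * (pi / 2)) \<le> C2 d"
proof (rule C2_lower_limit)
  fix J :: nat assume J: "J > 0"
  define s where "s = phase J"
  define F where "F = (\<lambda>x :: nat \<Rightarrow> complex. \<Sum>j<J. cis (- s j) * poly (cheb d) (x j))"
  define \<zeta> where "\<zeta> = (\<lambda>j. torus_pt (s j / real d))"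
  have sd: "\<bar>s j / real d\<bar> \<le> 53 / 100" if "j < J" for j
  proof -
    have "\<bar>s j / real d\<bar> = \<bar>s j\<bar> / real d" by simp
    also have "\<dots> \<le> (pi / 2) / 3"
      using abs_phase_le[OF that] d by (intro frac_le) (auto simp: s_def)
    also have "\<dots> \<le> 53 / 100" using pi_approx by simp
    finally show ?thesis .
  qed
  have "cmod (F \<zeta>) \<ge> real J * K"
  proof -
    define g where "g = (\<lambda>j. arsinh (cos (s j / real d)))"
    have "\<exists>\<eta>. cmod \<eta> = exp (- real d * g j) \<and>
        poly (cheb d) (\<zeta> j) = \<i> ^ d * (of_real (exp (real d * g j)) * cis (s j) + \<eta>) / 2" for j
      using cheb_torus_pt[of d "s j / real d"] d by (auto simp: g_def \<zeta>_def)
    then obtain \<eta> where \<eta>: "\<And>j. cmod (\<eta> j) = exp (- real d * g j)"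
      "\<And>j. poly (cheb d) (\<zeta> j) = \<i> ^ d * (of_real (exp (real d * g j)) * cis (s j) + \<eta> j) / 2"
      by metis
    have F: "F \<zeta> = \<i> ^ d * (\<Sum>j<J. (of_real (exp (real d * g j)) + cis (- s j) * \<eta> j) / 2)"
      unfolding F_def sum_distrib_left
    proof (intro sum.cong refl)
      fix j
      have "cis (- s j) * cis (s j) = 1" by (simp add: cis_mult)
      then show "cis (- s j) * poly (cheb d) (\<zeta> j) =
          \<i> ^ d * ((of_real (exp (real d * g j)) + cis (- s j) * \<eta> j) / 2)"
        unfolding \<eta>(2) by (simp add: algebra_simps)
    qed
    have "real J * K \<le> (\<Sum>j<J. ((1 + sqrt 2) ^ d * (1 - (382 / 1000) * (s j)\<^sup>2 / real d) - 1) / 2)"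
    proof -
      have "(\<Sum>j<J. ((1 + sqrt 2) ^ d * (1 - (382 / 1000) * (s j)\<^sup>2 / real d) - 1) / 2) =
        ((1 + sqrt 2) ^ d * (real J - (382 / 1000) / real d * (\<Sum>j<J. (s j)\<^sup>2)) - real J) / 2"
        by (simp add: sum_subtractf sum_distrib_left sum_divide_distrib right_diff_distrib diff_divide_distrib mult_ac)
      also have "\<dots> \<ge> ((1 + sqrt 2) ^ d * (real J - (382 / 1000) / real d * (real J * (pi\<^sup>2 / 12))) - real J) / 2"
        using sum_phase_square_le[OF J] unfolding s_def
        by (intro divide_right_mono diff_right_mono mult_left_mono diff_left_mono) auto
      also have "((1 + sqrt 2) ^ d * (real J - (382 / 1000) / real d * (real J * (pi\<^sup>2 / 12))) - real J) / 2 = real J * K"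
        unfolding K by (simp add: algebra_simps)
      finally show ?thesis .
    qed
    also have "\<dots> \<le> (\<Sum>j<J. Re ((of_real (exp (real d * g j)) + cis (- s j) * \<eta> j) / 2))"
    proof (rule sum_mono)
      fix j assume j: "j \<in> {..<J}"
      have "g j \<ge> arsinh 1 - (382 / 1000) * (s j / real d)\<^sup>2"
        unfolding g_def using sd j by (intro arsinh_cos_ge_coarse) auto
      from exp_growth_ge[OF this this, of d 0]
      have E: "exp (real d * g j) \<ge> (1 + sqrt 2) ^ d * (1 - (382 / 1000) * (s j)\<^sup>2 / real d)"
        using d by (simp add: power_divide power2_eq_square)
      have "(s j / real d)\<^sup>2 \<le> (53 / 100)\<^sup>2" using sd[of j] j abs_le_square_iff[of "s j / real d" "53/100"] by simp
      then have "cos (s j / real d) > 0"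
        using one_minus_square_le_cos[of "s j / real d"] by (simp add: power2_eq_square)
      \<comment> \<open>A positive growth rate keeps the reciprocal term in the unit disc; this
        accounts for the \<open>- 1\<close> in \<open>K\<close>.\<close>
      then have "g j > 0" by (simp add: g_def)
      then have "cmod (\<eta> j) \<le> 1" unfolding \<eta> by simp
      then have "Re (cis (- s j) * \<eta> j) \<ge> - 1"
        using abs_Re_le_cmod[of "cis (- s j) * \<eta> j"] by (simp add: norm_mult abs_le_iff)
      then show "((1 + sqrt 2) ^ d * (1 - (382 / 1000) * (s j)\<^sup>2 / real d) - 1) / 2 \<le>
          Re ((of_real (exp (real d * g j)) + cis (- s j) * \<eta> j) / 2)"
        using E by (simp del: times_complex.sel)
    qed
    also have "\<dots> = Re (\<Sum>j<J. (of_real (exp (real d * g j)) + cis (- s j) * \<eta> j) / 2)" by simp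
    also have "\<dots> \<le> cmod (F \<zeta>)"
      unfolding F norm_mult norm_power by (simp del: Re_sum add: complex_Re_le_cmod)
    finally show ?thesis .
  qed
  moreover have "cmod (F x) \<le> 1 / sin (pi / (2 * real J))"
    if x: "\<And>v. v < J \<Longrightarrow> x v \<in> of_real ` {-1..1}" for x
  proof (rule norm_le_of_real_parts)
    fix \<psi>
    have "\<exists>t. j < J \<longrightarrow> x j = of_real (cos t)" for j
      using x[of j] cube_pointE by blast
    then obtain t where t: "\<And>j. j < J \<Longrightarrow> x j = of_real (cos (t j))" by metis
    have "Re (cis (- \<psi>) * F x) = (\<Sum>j<J. cos (real d * t j) * cos (\<psi> + s j))"
      unfolding F_def sum_distrib_left Re_sum
    proof (intro sum.cong refl)
      fix j assume "j \<in> {..<J}"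
      then have "cis (- \<psi>) * (cis (- s j) * poly (cheb d) (x j)) =
          cis (- (\<psi> + s j)) * of_real (cos (real d * t j))"
        by (simp add: t cheb_cos cis_mult flip: mult.assoc)
      then show "Re (cis (- \<psi>) * (cis (- s j) * poly (cheb d) (x j))) = cos (real d * t j) * cos (\<psi> + s j)"
        using cos_minus[of "\<psi> + s j"] by simp
    qed
    also have "\<dots> \<le> (\<Sum>j<J. \<bar>cos (\<psi> + s j)\<bar>)"
    proof (rule sum_mono)
      fix j
      have "\<bar>cos (real d * t j)\<bar> * \<bar>cos (\<psi> + s j)\<bar> \<le> 1 * \<bar>cos (\<psi> + s j)\<bar>"
        by (intro mult_right_mono) auto
      then show "cos (real d * t j) * cos (\<psi> + s j) \<le> \<bar>cos (\<psi> + s j)\<bar>"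
        by (simp flip: abs_mult)
    qed
    also have "\<dots> \<le> 1 / sin (pi / (2 * real J))"
      unfolding s_def by (rule sum_abs_cos_le[OF J])
    finally show "Re (cis (- \<psi>) * F x) \<le> 1 / sin (pi / (2 * real J))" .
  qed
  moreover have "approximable J d F"
    unfolding F_def by (intro approximable_sum approximable_cmult approximable_poly degree_cheb) auto
  ultimately have "ereal (real J * K / (1 / sin (pi / (2 * real J)))) \<le> C2 d"
    using J K(2) sin_half_step_pos[OF J]
    by (intro C2_lower_approximable[of J d F _ \<zeta>]) (auto simp: \<zeta>_def cmod_torus_pt)
  then show "ereal (K * (real J * sin (pi / (2 * real J)))) \<le> C2 d"
    by (simp add: mult_ac)
qed

section \<open>Numerical verification for degrees 3 to 10\<close>

text \<open>\<open>pi / 4\<close> is the limiting constant of the plain Chebyshev construction, so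
  the factor 10835 / 10000 is the deficit to be made up in small degrees.\<close>

lemma beta_const_le: "beta_const \<le> pi / 4 * (10835 / 10000)"
proof -
  have "sqrt 26 \<ge> 5099 / 1000" by (rule real_le_rsqrt) (simp add: power2_eq_square)
  moreover have "exp (22 / 10 :: real) \<le> 10"
  proof -
    have "exp (22 / 10 :: real) = exp 1 * exp 1 * exp (1 / 5)" by (simp flip: exp_add)
    also have "\<dots> \<le> (272 / 100) * (272 / 100) * (125 / 100)"
    proof (intro mult_mono)
      show "exp 1 \<le> ((272 / 100) :: real)" "exp 1 \<le> ((272 / 100) :: real)" using e_less_272 by auto
      have "exp (1 / 5 :: real) \<le> 1 + 1 / 5 + (1 / 5)\<^sup>2" by (rule exp_bound) auto
      then show "exp (1 / 5 :: real) \<le> (125 / 100)" by (simp add: power2_eq_square)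
    qed auto
    finally show ?thesis by simp
  qed
  then have "(22 / 10) \<le> ln (10 :: real)" by (subst ln_ge_iff) auto
  moreover have "ln (10 :: real) \<le> ln (5 + sqrt 26)" using \<open>sqrt 26 \<ge> 5099 / 1000\<close> by simp
  ultimately have "5 * sqrt 26 + ln (5 + sqrt 26) \<ge> 2769 / 100" by linarith
  then have "beta_const \<le> 15 * pi / (2 * (2769 / 100))"
    unfolding beta_const_def by (intro divide_left_mono mult_left_mono) auto
  also have "\<dots> \<le> pi / 4 * (10835 / 10000)" by simp
  finally show ?thesis .
qed

lemma pi_square_le: "pi\<^sup>2 \<le> 987 / 100"
  using power_mono[OF pi_approx(2), of 2] by (simp add: power2_eq_square)

text \<open>The correction \<open>6 / (5 * d)\<close> far exceeds the actual loss of about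
  \<open>0.315 / d\<close>; up to \<open>d = 10\<close> the difference pays for the deficit of 835 /
  10000 and for the additive 1.\<close>

lemma small_degree_estimate:
  assumes d: "3 \<le> d" "d \<le> 10"
  shows "10835 / 10000 * (1 - 6 / (5 * real d)) * (1 + sqrt 2) ^ d \<le>
         (1 + sqrt 2) ^ d * (1 - (382 / 1000) * pi\<^sup>2 / (12 * real d)) - 1"
proof -
  define t where "t = 1 / real d"
  have t: "1 / 10 \<le> t" "t \<le> 1 / 3" using d by (auto simp: t_def field_simps)
  have "d \<in> {3, 4, 5, 6, 7, 8, 9, 10}" using d by auto
  \<comment> \<open>Checked degree by degree; it bounds the additive loss 1 by
    \<open>t\<^sup>2 * (1 + sqrt 2) ^ d\<close>.\<close>
  then have "(real d)\<^sup>2 \<le> (12 / 5) ^ d"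
    by (auto simp: power2_eq_square eval_nat_numeral)
  also have "sqrt 2 \<ge> 7 / 5" by (rule real_le_rsqrt) (simp add: power2_eq_square)
  then have "(12 / 5) ^ d \<le> (1 + sqrt 2) ^ d" by (intro power_mono) auto
  finally have "(real d)\<^sup>2 * t\<^sup>2 \<le> (1 + sqrt 2) ^ d * t\<^sup>2" by (rule mult_right_mono) simp
  then have *: "1 \<le> (1 + sqrt 2) ^ d * t\<^sup>2" using d by (simp add: t_def power_divide)
  \<comment> \<open>On \<open>[1 / 10, 1 / 3]\<close> the parabola \<open>t\<^sup>2\<close> lies
    below its chord, which makes the remaining inequality linear.\<close>
  have "(t - 1 / 10) * (1 / 3 - t) \<ge> 0" using t by (intro mult_nonneg_nonneg) auto
  also have "(t - 1 / 10) * (1 / 3 - t) = 13 / 30 * t - 1 / 30 - t\<^sup>2"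
    by (simp add: power2_eq_square field_simps)
  finally have "t\<^sup>2 \<le> 13 / 30 * t - 1 / 30" by simp
  moreover have "(382 / 1000) * pi\<^sup>2 / 12 \<le> 315 / 1000" using pi_square_le by simp
  then have "(382 / 1000) * pi\<^sup>2 / 12 * t \<le> 315 / 1000 * t"
    using t by (intro mult_right_mono) auto
  moreover have "10835 / 10000 * (1 - 6 / 5 * t) \<le> 1 - w - q"
    if "q \<le> 13 / 30 * t - 1 / 30" "w \<le> 315 / 1000 * t" for q w :: real
    using that t by (simp add: field_simps)
  ultimately have "10835 / 10000 * (1 - 6 / 5 * t) \<le> 1 - (382 / 1000) * pi\<^sup>2 / 12 * t - t\<^sup>2"
    by blast
  then have "(1 + sqrt 2) ^ d * (10835 / 10000 * (1 - 6 / 5 * t)) \<le>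
      (1 + sqrt 2) ^ d * (1 - (382 / 1000) * pi\<^sup>2 / 12 * t - t\<^sup>2)"
    by (rule mult_left_mono) simp
  also have "\<dots> \<le> (1 + sqrt 2) ^ d * (1 - (382 / 1000) * pi\<^sup>2 / 12 * t) - 1"
    using * by (simp add: algebra_simps)
  finally show ?thesis by (simp add: t_def mult_ac)
qed

lemma beta_lower_small:
  assumes d: "3 \<le> d" "d \<le> 10"
  shows "ereal (beta_const * (1 - 6 / (5 * real d)) * (1 + sqrt 2) ^ d) \<le> C2 d"
proof -
  define K where "K = ((1 + sqrt 2) ^ d * (1 - (382 / 1000) * pi\<^sup>2 / (12 * real d)) - 1) / 2"
  have pos: "(1 - 6 / (5 * real d)) * (1 + sqrt 2) ^ d > 0"
    using d by (intro mult_pos_pos zero_less_power) (auto simp: field_simps add_pos_pos)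
  have K: "10835 / 10000 * (1 - 6 / (5 * real d)) * (1 + sqrt 2) ^ d \<le> 2 * K"
  proof -
    have half: "2 * (a / 2) = a" for a :: real by simp
    show ?thesis unfolding K_def half by (rule small_degree_estimate[OF d])
  qed
  moreover have "10835 / 10000 * (1 - 6 / (5 * real d)) * (1 + sqrt 2) ^ d > 0"
    using mult_pos_pos[OF _ pos, of "10835 / 10000"] by (simp only: mult.assoc)
  ultimately have "K > 0" by linarith
  have "beta_const * ((1 - 6 / (5 * real d)) * (1 + sqrt 2) ^ d) \<le>
        pi / 4 * (10835 / 10000) * ((1 - 6 / (5 * real d)) * (1 + sqrt 2) ^ d)"
    using beta_const_le pos by (intro mult_right_mono) auto
  also have "\<dots> = pi / 4 * (10835 / 10000 * (1 - 6 / (5 * real d)) * (1 + sqrt 2) ^ d)"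
    by simp
  also have "\<dots> \<le> pi / 4 * (2 * K)"
    using K by (intro mult_left_mono) auto
  finally have "beta_const * (1 - 6 / (5 * real d)) * (1 + sqrt 2) ^ d \<le> K * (pi / 2)"
    by (simp add: mult_ac)
  then have "ereal (beta_const * (1 - 6 / (5 * real d)) * (1 + sqrt 2) ^ d) \<le> ereal (K * (pi / 2))"
    by simp
  also have "\<dots> \<le> C2 d"
    using \<open>K > 0\<close> d by (intro C2_lower_small) (auto simp: K_def)
  finally show ?thesis .
qed

section \<open>The lower bound for large degrees\<close>

text \<open>
  With half angles \<open>\<alpha> = d x / 2\<close> and \<open>\<beta> = d y / 2\<close> the first term is \<open>\<bar>cos\<^sup>2 \<alpha> - cos\<^sup>2 \<beta>\<bar>\<close>, while the
  second is dominated by the square of \<open>max \<bar>cos \<alpha> cos \<beta>\<bar> \<bar>sin \<alpha> sin \<beta>\<bar>\<close>.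
\<close>

lemma cos_pair_bound:
  fixes x y :: real and k l :: nat
  defines "X \<equiv> (cos (real (k + l) * x) - cos (real (k + l) * y)) / 2"
    and "U \<equiv> (cos (real k * x) * cos (real l * y) + cos (real l * x) * cos (real k * y)) / 2"
  shows "\<bar>X\<bar> \<le> 1 - U\<^sup>2" "\<bar>U\<bar> \<le> 1"
proof -
  define \<alpha> \<beta> m where "\<alpha> = real (k + l) * x / 2" and "\<beta> = real (k + l) * y / 2" and "m = (real l - real k) / 2"
  define a b c e where "a = cos \<alpha>" and "b = cos \<beta>" and "c = sin \<alpha>" and "e = sin \<beta>"
  have ac: "a\<^sup>2 + c\<^sup>2 = 1" and be: "b\<^sup>2 + e\<^sup>2 = 1" by (simp_all add: a_def b_def c_def e_def)
  have X: "X = a\<^sup>2 - b\<^sup>2"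
  proof -
    have "real (k + l) * x = 2 * \<alpha>" "real (k + l) * y = 2 * \<beta>" by (simp_all add: \<alpha>_def \<beta>_def)
    then show ?thesis unfolding X_def a_def b_def by (simp only: cos_double_cos) simp
  qed
  have ang: "real k * x = \<alpha> - m * x" "real l * y = \<beta> + m * y" "real l * x = \<alpha> + m * x" "real k * y = \<beta> - m * y"
    by (simp_all add: \<alpha>_def \<beta>_def m_def field_simps)
  have U: "U = a * b * (cos (m * x) * cos (m * y)) - c * e * (sin (m * x) * sin (m * y))"
    unfolding U_def ang cos_add cos_diff a_def b_def c_def e_def by (simp add: field_simps)
  define M where "M = max \<bar>a * b\<bar> \<bar>c * e\<bar>"
  have "\<bar>U\<bar> \<le> \<bar>a * b\<bar> * \<bar>cos (m * x) * cos (m * y)\<bar> + \<bar>c * e\<bar> * \<bar>sin (m * x) * sin (m * y)\<bar>"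
    unfolding U abs_mult[symmetric] by (rule abs_triangle_ineq4)
  also have "\<dots> \<le> M * \<bar>cos (m * x) * cos (m * y)\<bar> + M * \<bar>sin (m * x) * sin (m * y)\<bar>"
    by (intro add_mono mult_right_mono) (auto simp: M_def)
  also have "\<dots> = M * (\<bar>cos (m * x) * cos (m * y)\<bar> + \<bar>sin (m * x) * sin (m * y)\<bar>)"
    by (simp add: algebra_simps)
  also have "\<dots> \<le> M * 1"
  proof (rule mult_left_mono)
    \<comment> \<open>Up to sign, the sum of the two moduli is one of these two cosines.\<close>
    have "\<bar>cos (m * x - m * y)\<bar> \<le> 1" "\<bar>cos (m * x + m * y)\<bar> \<le> 1" by simp_all
    then show "\<bar>cos (m * x) * cos (m * y)\<bar> + \<bar>sin (m * x) * sin (m * y)\<bar> \<le> 1"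
      unfolding cos_add cos_diff by linarith
  qed (simp add: M_def)
  finally have UM: "\<bar>U\<bar> \<le> M" by simp
  have sq: "\<bar>a\<^sup>2 - b\<^sup>2\<bar> \<le> 1 - (a * b)\<^sup>2" "\<bar>a\<^sup>2 - b\<^sup>2\<bar> \<le> 1 - (c * e)\<^sup>2"
  proof -
    have *: "\<bar>p - q\<bar> \<le> 1 - p * q" if "0 \<le> p" "p \<le> 1" "0 \<le> q" "q \<le> 1" for p q :: real
    proof -
      \<comment> \<open>These products are \<open>1 - p * q - (p - q)\<close> and
        \<open>1 - p * q - (q - p)\<close>.\<close>
      have "(1 - p) * (1 + q) \<ge> 0" "(1 + p) * (1 - q) \<ge> 0" using that by auto
      then show ?thesis by (simp add: algebra_simps abs_le_iff)
    qed
    have le1: "a\<^sup>2 \<le> 1" "b\<^sup>2 \<le> 1" "c\<^sup>2 \<le> 1" "e\<^sup>2 \<le> 1" using ac be by (smt (verit) zero_le_power2)+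
    have "\<bar>a\<^sup>2 - b\<^sup>2\<bar> = \<bar>c\<^sup>2 - e\<^sup>2\<bar>" using ac be by linarith
    then show "\<bar>a\<^sup>2 - b\<^sup>2\<bar> \<le> 1 - (a * b)\<^sup>2" "\<bar>a\<^sup>2 - b\<^sup>2\<bar> \<le> 1 - (c * e)\<^sup>2"
      using *[of "a\<^sup>2" "b\<^sup>2"] *[of "c\<^sup>2" "e\<^sup>2"] le1 by (simp_all add: power_mult_distrib)
  qed
  have "M\<^sup>2 = (a * b)\<^sup>2 \<or> M\<^sup>2 = (c * e)\<^sup>2"
    unfolding M_def max_def by (simp split: if_splits)
  then have XM: "\<bar>X\<bar> \<le> 1 - M\<^sup>2" unfolding X using sq by auto
  have UM2: "U\<^sup>2 \<le> M\<^sup>2" using power_mono[OF UM, of 2] by simp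
  then show "\<bar>X\<bar> \<le> 1 - U\<^sup>2" using XM by linarith
  have "U\<^sup>2 \<le> 1" using UM2 XM by linarith
  then show "\<bar>U\<bar> \<le> 1" by (simp add: abs_square_le_1)
qed

text \<open>
  The lens \<open>\<bar>X\<bar> \<le> 1 - u\<^sup>2\<close>, \<open>Y = 2 e u\<close> is the integral over \<open>v\<close> in \<open>[-1, 1]\<close> of the segments
  spanned by the boundary tangents \<open>(v, - e)\<close>; this reduces the mean width to that of a segment.
\<close>

lemma lens_support_le:
  fixes u X c s e :: real
  assumes u: "\<bar>u\<bar> \<le> 1" and X: "\<bar>X\<bar> \<le> 1 - u\<^sup>2"
  shows "X * c + 2 * e * u * s \<le> integral {-1..1} (\<lambda>v. \<bar>v * c - e * s\<bar>)"
proof -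
  have int: "(\<lambda>v. \<bar>v * c - e * s\<bar>) integrable_on {a..b}" for a b :: real
    by (intro integrable_continuous_interval continuous_intros)
  have lin: "((\<lambda>v. v * c - e * s) has_integral ((b\<^sup>2 - a\<^sup>2) * c / 2 - e * s * (b - a))) {a..b}"
    if "a \<le> b" for a b :: real
  proof -
    have "((\<lambda>v. v * c - e * s) has_integral ((b\<^sup>2 * c / 2 - e * s * b) - (a\<^sup>2 * c / 2 - e * s * a))) {a..b}"
      using that by (intro fundamental_theorem_of_calculus)
        (auto intro!: derivative_eq_intros simp flip: has_real_derivative_iff_has_vector_derivative)
    then show ?thesis by (simp add: algebra_simps diff_divide_distrib)
  qed
  have pos: "(b\<^sup>2 - a\<^sup>2) * c / 2 - e * s * (b - a) \<le> integral {a..b} (\<lambda>v. \<bar>v * c - e * s\<bar>)"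
    and neg: "- ((b\<^sup>2 - a\<^sup>2) * c / 2 - e * s * (b - a)) \<le> integral {a..b} (\<lambda>v. \<bar>v * c - e * s\<bar>)"
    if "a \<le> b" for a b :: real
  proof -
    show "(b\<^sup>2 - a\<^sup>2) * c / 2 - e * s * (b - a) \<le> integral {a..b} (\<lambda>v. \<bar>v * c - e * s\<bar>)"
      by (rule has_integral_le[OF lin[OF that] integrable_integral[OF int]]) auto
    show "- ((b\<^sup>2 - a\<^sup>2) * c / 2 - e * s * (b - a)) \<le> integral {a..b} (\<lambda>v. \<bar>v * c - e * s\<bar>)"
      by (rule has_integral_le[OF has_integral_neg[OF lin[OF that]] integrable_integral[OF int]]) auto
  qed
  have split: "integral {-1..1} (\<lambda>v. \<bar>v * c - e * s\<bar>) =
      integral {-1..w} (\<lambda>v. \<bar>v * c - e * s\<bar>) + integral {w..1} (\<lambda>v. \<bar>v * c - e * s\<bar>)" if "\<bar>w\<bar> \<le> 1" for w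
    using that by (intro Henstock_Kurzweil_Integration.integral_combine[symmetric] int) auto
  have "X * c \<le> \<bar>X\<bar> * \<bar>c\<bar>" by (metis abs_ge_self abs_mult)
  also have "\<dots> \<le> (1 - u\<^sup>2) * \<bar>c\<bar>" using X by (intro mult_right_mono) auto
  finally have Xc: "X * c \<le> (1 - u\<^sup>2) * \<bar>c\<bar>" .
  have u': "-1 \<le> u" "u \<le> 1" using u by auto
  show ?thesis
  proof (cases "c \<ge> 0")
    case True
    \<comment> \<open>Replacing the modulus by minus its argument on \<open>[-1, u]\<close> and by
      its argument on \<open>[u, 1]\<close> gives exactly the left side. For \<open>c < 0\<close>
      the split is at \<open>- u\<close> and the signs are exchanged.\<close>
    have "(1 - u\<^sup>2) * c + 2 * e * u * s \<le> integral {-1..1} (\<lambda>v. \<bar>v * c - e * s\<bar>)"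
      using neg[of "-1" u] pos[of u 1] u' unfolding split[OF u] by (simp add: field_simps)
    then show ?thesis using Xc True by simp
  next
    case False
    have "\<bar>- u\<bar> \<le> 1" using u by simp
    then have "(1 - u\<^sup>2) * (- c) + 2 * e * u * s \<le> integral {-1..1} (\<lambda>v. \<bar>v * c - e * s\<bar>)"
      using pos[of "-1" "-u"] neg[of "-u" 1] u' unfolding split[OF \<open>\<bar>- u\<bar> \<le> 1\<close>] by (simp add: field_simps)
    then show ?thesis using Xc False by simp
  qed
qed

section \<open>Perimeter and mean width of the lens\<close>

text \<open>The integrand is the length of the tangent \<open>(v, - 1 / 5)\<close>, so the integral
  is a quarter of the perimeter of the lens with \<open>e = 1 / 5\<close>.\<close>

lemma integral_arc_length:
  "((\<lambda>v. sqrt (v\<^sup>2 + (1 / 5)\<^sup>2)) has_integral ((5 * sqrt 26 + ln (5 + sqrt 26)) / 25)) {-1..1}"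
proof -
  define G where "G = (\<lambda>v::real. (v * sqrt (v\<^sup>2 + (1 / 5)\<^sup>2) + (1 / 5)\<^sup>2 * arsinh (5 * v)) / 2)"
  have "(G has_real_derivative sqrt (v\<^sup>2 + (1 / 5)\<^sup>2)) (at v within {-1..1})" for v
  proof -
    define r where "r = sqrt (v\<^sup>2 + (1 / 5)\<^sup>2)"
    have pos: "v\<^sup>2 + (1 / 5)\<^sup>2 > 0" by (intro add_nonneg_pos) auto
    then have r: "r > 0" "r\<^sup>2 = v\<^sup>2 + (1 / 5)\<^sup>2" by (auto simp: r_def)
    have "sqrt ((5 * v)\<^sup>2 + 1) = 5 * r"
      by (rule real_sqrt_unique) (use r in \<open>simp_all add: power_mult_distrib power_divide\<close>)
    then have "(arsinh has_real_derivative 1 / (5 * r)) (at (5 * v))"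
      using arsinh_real_has_field_derivative[of "5 * v"] by simp
    then have "((\<lambda>v. arsinh (5 * v)) has_real_derivative 1 / (5 * r) * 5) (at v within {-1..1})"
      by (rule DERIV_chain2) (auto intro!: derivative_eq_intros)
    moreover have "((\<lambda>v. sqrt (v\<^sup>2 + (1 / 5)\<^sup>2)) has_real_derivative v / r) (at v within {-1..1})"
    proof -
      have "((\<lambda>v. v\<^sup>2 + (1 / 5)\<^sup>2) has_real_derivative 2 * v) (at v within {-1..1})"
        by (auto intro!: derivative_eq_intros)
      from DERIV_chain2[OF DERIV_real_sqrt[OF pos] this] show ?thesis
        by (rule DERIV_cong) (simp add: r_def[symmetric] inverse_eq_divide)
    qed
    ultimately have "(G has_real_derivative (1 * sqrt (v\<^sup>2 + (1 / 5)\<^sup>2) + v / r * v + (1 / 5)\<^sup>2 * (1 / (5 * r) * 5)) / 2) (at v within {-1..1})"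
      unfolding G_def by (intro DERIV_cdivide DERIV_add DERIV_cmult DERIV_mult DERIV_ident)
    also have "sqrt (v\<^sup>2 + (1 / 5)\<^sup>2) = r" by (simp add: r_def)
    also have "(1 * r + v / r * v + (1 / 5)\<^sup>2 * (1 / (5 * r) * 5)) / 2 = r"
    proof -
      have "v / r * v + (1 / 5)\<^sup>2 * (1 / (5 * r) * 5) = (v\<^sup>2 + (1 / 5)\<^sup>2) / r"
        by (simp add: add_divide_distrib power2_eq_square)
      also have "\<dots> = r" unfolding r(2)[symmetric] using r(1) by (simp add: power2_eq_square)
      finally show ?thesis by simp
    qed
    finally show ?thesis by (simp add: r_def)
  qed
  then have "((\<lambda>v. sqrt (v\<^sup>2 + (1 / 5)\<^sup>2)) has_integral (G 1 - G (-1))) {-1..1}"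
    by (intro fundamental_theorem_of_calculus) (auto simp flip: has_real_derivative_iff_has_vector_derivative)
  moreover have "G 1 - G (-1) = (5 * sqrt 26 + ln (5 + sqrt 26)) / 25"
  proof -
    have s: "sqrt (26 / 25) = sqrt 26 / 5"
      by (rule real_sqrt_unique) (simp_all add: power_divide)
    have "arsinh (5::real) = ln (5 + sqrt 26)" by (simp add: arsinh_real_def)
    then show ?thesis using arsinh_minus_real[of 5] by (simp add: G_def power2_eq_square s field_simps)
  qed
  ultimately show ?thesis by simp
qed

text \<open>After exchanging sum and integral, each \<open>v\<close> leaves a segment. In polar
  coordinates \<open>(r, \<omega>)\<close> of \<open>(v, 1 / 5)\<close> its contribution is bounded
  by \<open>sum_abs_cos_le\<close> with the factor \<open>r\<close>, and integrating
  \<open>r\<close> gives the arc length.\<close>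

lemma sum_lens_support_le:
  assumes J: "J > 0" and u: "\<And>j. j < J \<Longrightarrow> \<bar>u j\<bar> \<le> 1" and X: "\<And>j. j < J \<Longrightarrow> \<bar>X j\<bar> \<le> 1 - (u j)\<^sup>2"
  shows "(\<Sum>j<J. X j * cos (\<psi> + phase J j) + 2 * (1 / 5) * u j * sin (\<psi> + phase J j)) \<le>
    (5 * sqrt 26 + ln (5 + sqrt 26)) / 25 / sin (pi / (2 * real J))"
proof -
  have int: "(\<lambda>v. \<bar>v * c - 1 / 5 * s\<bar>) integrable_on {-1..1}" for c s :: real
    by (intro integrable_continuous_interval continuous_intros)
  have "(\<Sum>j<J. X j * cos (\<psi> + phase J j) + 2 * (1 / 5) * u j * sin (\<psi> + phase J j)) \<le>
     (\<Sum>j<J. integral {-1..1} (\<lambda>v. \<bar>v * cos (\<psi> + phase J j) - 1 / 5 * sin (\<psi> + phase J j)\<bar>))"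
    using u X by (intro sum_mono lens_support_le) auto
  also have "\<dots> = integral {-1..1} (\<lambda>v. \<Sum>j<J. \<bar>v * cos (\<psi> + phase J j) - 1 / 5 * sin (\<psi> + phase J j)\<bar>)"
    by (rule integral_sum[symmetric, OF finite_lessThan int])
  also have "\<dots> \<le> (5 * sqrt 26 + ln (5 + sqrt 26)) / 25 * (1 / sin (pi / (2 * real J)))"
  proof (rule has_integral_le[OF integrable_integral has_integral_mult_left[OF integral_arc_length]])
    show "(\<lambda>v. \<Sum>j<J. \<bar>v * cos (\<psi> + phase J j) - 1 / 5 * sin (\<psi> + phase J j)\<bar>) integrable_on {-1..1}"
      by (intro integrable_sum int) auto
    fix v :: real
    define z r \<omega> where "z = Complex v (1 / 5)" and "r = cmod z" and "\<omega> = Arg z"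
    have r: "r = sqrt (v\<^sup>2 + (1 / 5)\<^sup>2)" "v = r * cos \<omega>" "1 / 5 = r * sin \<omega>"
    proof -
      have z: "rcis r \<omega> = z" by (simp add: r_def \<omega>_def rcis_cmod_Arg)
      show "v = r * cos \<omega>" using arg_cong[OF z, of Re] by (simp add: z_def)
      show "1 / 5 = r * sin \<omega>" using arg_cong[OF z, of Im] by (simp add: z_def)
    qed (simp add: r_def z_def cmod_def)
    have "r \<ge> 0" by (simp add: r(1))
    have "(\<Sum>j<J. \<bar>v * cos (\<psi> + phase J j) - 1 / 5 * sin (\<psi> + phase J j)\<bar>) =
        (\<Sum>j<J. r * \<bar>cos ((\<omega> + \<psi>) + phase J j)\<bar>)"
    proof (rule sum.cong[OF refl])
      fix j
      have "r * \<bar>cos ((\<omega> + \<psi>) + phase J j)\<bar> = \<bar>r * cos (\<omega> + (\<psi> + phase J j))\<bar>"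
        using \<open>r \<ge> 0\<close> by (simp add: abs_mult add.assoc)
      also have "r * cos (\<omega> + (\<psi> + phase J j)) = v * cos (\<psi> + phase J j) - 1 / 5 * sin (\<psi> + phase J j)"
        unfolding r(2,3) cos_add[of \<omega>] by (simp add: algebra_simps)
      finally show "\<bar>v * cos (\<psi> + phase J j) - 1 / 5 * sin (\<psi> + phase J j)\<bar> = r * \<bar>cos ((\<omega> + \<psi>) + phase J j)\<bar>" ..
    qed
    also have "\<dots> \<le> r * (1 / sin (pi / (2 * real J)))"
      unfolding sum_distrib_left[symmetric]
      using sum_abs_cos_le[OF J, of "\<omega> + \<psi>"] \<open>r \<ge> 0\<close> by (intro mult_left_mono) auto
    finally show "(\<Sum>j<J. \<bar>v * cos (\<psi> + phase J j) - 1 / 5 * sin (\<psi> + phase J j)\<bar>)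
      \<le> sqrt (v\<^sup>2 + (1 / 5)\<^sup>2) * (1 / sin (pi / (2 * real J)))" by (simp add: r(1))
  qed
  finally show ?thesis by simp
qed

section \<open>The two-variable polynomial on the square and at points of the torus\<close>

definition pair_poly :: "nat \<Rightarrow> nat \<Rightarrow> complex \<Rightarrow> complex \<Rightarrow> complex" where
  "pair_poly k l x y =
     (poly (cheb (k + l)) x - poly (cheb (k + l)) y) / 2 +
     \<i> * (2 / 5) * ((poly (cheb k) x * poly (cheb l) y + poly (cheb l) x * poly (cheb k) y) / 2)"

lemma approximable_pair_poly:
  assumes "v < n" "w < n"
  shows "approximable n (k + l) (\<lambda>x. pair_poly k l (x v) (x w))"
proof -
  have eq: "(\<lambda>x. pair_poly k l (x v) (x w)) = (\<lambda>x.
      (1 / 2 * poly (cheb (k + l)) (x v) + - 1 / 2 * poly (cheb (k + l)) (x w)) +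
      (\<i> / 5 * (poly (cheb k) (x v) * poly (cheb l) (x w)) + \<i> / 5 * (poly (cheb l) (x v) * poly (cheb k) (x w))))"
    by (simp add: pair_poly_def fun_eq_iff algebra_simps diff_divide_distrib add_divide_distrib)
  have "degree (cheb k) + degree (cheb l) \<le> k + l" "degree (cheb l) + degree (cheb k) \<le> k + l"
    using degree_cheb[of k] degree_cheb[of l] by auto
  then show ?thesis
    unfolding eq using assms
    by (intro approximable_add approximable_cmult approximable_poly approximable_poly_mult degree_cheb)
qed

text \<open>The parts have the form \<open>X\<close> and \<open>2 * e * U\<close> with
  \<open>e = 1 / 5\<close>, to which \<open>cos_pair_bound\<close> and
  \<open>sum_lens_support_le\<close> apply.\<close>

lemma pair_poly_real:
  "pair_poly k l (of_real (cos x)) (of_real (cos y)) =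
   Complex ((cos (real (k + l) * x) - cos (real (k + l) * y)) / 2)
     (2 * (1 / 5) * ((cos (real k * x) * cos (real l * y) + cos (real l * x) * cos (real k * y)) / 2))"
  by (simp add: pair_poly_def cheb_cos complex_eq_iff)

text \<open>The main product has phase \<open>\<alpha> + \<beta> - s\<close>; the three terms
  containing \<open>a\<close> or \<open>b\<close> are estimated by their moduli.\<close>

lemma Re_perturbed_product_ge:
  assumes "A \<ge> 0" "B \<ge> 0"
  shows "Re (cis (- s) * ((of_real A * cis \<alpha> + a) * (of_real B * cis \<beta> + b))) \<ge>
    A * B * cos (\<alpha> + \<beta> - s) - (A * cmod b + cmod a * B + cmod a * cmod b)"
proof -
  define r where "r = cis (- s) * (of_real A * cis \<alpha> * b + a * (of_real B * cis \<beta>) + a * b)"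
  have "cis (- s) * cis \<alpha> * cis \<beta> = cis (\<alpha> + \<beta> - s)" by (simp add: cis_mult algebra_simps)
  then have "cis (- s) * ((of_real A * cis \<alpha> + a) * (of_real B * cis \<beta> + b)) =
      of_real (A * B) * cis (\<alpha> + \<beta> - s) + r"
    unfolding r_def of_real_mult by (auto simp: algebra_simps)
  moreover have "cmod r \<le> A * cmod b + cmod a * B + cmod a * cmod b"
    unfolding r_def norm_mult norm_cis mult_1
    using assms by (intro order.trans[OF norm_triangle_ineq] add_mono) (auto simp: norm_mult)
  moreover have "Re r \<ge> - cmod r" using abs_Re_le_cmod[of r] by simp
  ultimately show ?thesis by (simp del: of_real_mult)
qed

text \<open>The lower bound makes reciprocal powers decay at least like powers of 1 / 2:
  \<open>cos x \<ge> 3 / 4\<close> forces the square root in \<open>arsinh\<close> to be at least 5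
  / 4, and the two add up to 2.\<close>

lemma growth_bounds:
  fixes x :: real
  assumes "\<bar>x\<bar> \<le> 3 / 10"
  shows "arsinh (cos x) \<le> arsinh 1" "ln 2 \<le> arsinh (cos x)"
proof -
  show "arsinh (cos x) \<le> arsinh 1" using cos_le_one[of x] by (simp add: linorder_not_less[symmetric])
  have "x\<^sup>2 \<le> (3 / 10)\<^sup>2" using assms abs_le_square_iff[of x "3 / 10"] by simp
  then have c: "cos x \<ge> 3 / 4" using one_minus_square_le_cos[of x] by (simp add: power2_eq_square)
  have "(cos x)\<^sup>2 \<ge> (3 / 4)\<^sup>2" using c by (intro power_mono) auto
  then have "sqrt ((cos x)\<^sup>2 + 1) \<ge> 5 / 4" by (intro real_le_rsqrt) (simp add: power2_eq_square)
  then have "2 \<le> cos x + sqrt ((cos x)\<^sup>2 + 1)" using c by simp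
  then show "ln 2 \<le> arsinh (cos x)" by (simp add: arsinh_real_def)
qed

text \<open>Errors are measured against \<open>(1 + sqrt 2) ^ n\<close>, the scale of the main
  terms; \<open>1 / 2 = 2 * (1 / 4)\<close> and \<open>2 \<le> 1 + sqrt 2\<close>.\<close>

lemma exp_noise_le:
  assumes "g \<ge> ln 2"
  shows "exp (- (real n * g)) \<le> (1 + sqrt 2) ^ n * (1 / 4) ^ n"
proof -
  have "exp (- (real n * g)) \<le> exp (real n * - ln 2)"
    using assms by (simp add: mult_left_mono)
  also have "\<dots> = (1 / 2) ^ n"
    unfolding exp_of_nat_mult by (simp add: exp_minus inverse_eq_divide)
  also have "\<dots> = 2 ^ n * (1 / 4) ^ n" by (simp flip: power_mult_distrib)
  also have "\<dots> \<le> (1 + sqrt 2) ^ n * (1 / 4) ^ n"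
    by (intro mult_right_mono power_mono) auto
  finally show ?thesis .
qed

lemma exp_mixed_noise_le:
  assumes "g1 \<le> arsinh 1" "g2 \<ge> ln 2" "k \<le> n"
  shows "exp (real m * g1) * exp (- (real n * g2)) \<le> (1 + sqrt 2) ^ (m + n) * (1 / 4) ^ k"
proof -
  have "exp (real m * g1) \<le> (1 + sqrt 2) ^ m"
    unfolding exp_arsinh_1[symmetric] using assms by (simp add: mult_left_mono)
  then have "exp (real m * g1) * exp (- (real n * g2)) \<le> (1 + sqrt 2) ^ m * ((1 + sqrt 2) ^ n * (1 / 4) ^ n)"
    using exp_noise_le[OF assms(2), of n] by (intro mult_mono) auto
  also have "\<dots> \<le> (1 + sqrt 2) ^ m * ((1 + sqrt 2) ^ n * (1 / 4) ^ k)"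
    using assms(3) by (intro mult_left_mono power_decreasing) auto
  finally show ?thesis by (simp add: power_add mult.assoc)
qed

text \<open>
  At these points \<open>cheb (k + l)\<close> has the phases \<open>\<plusminus>\<i> cis s\<close> and both products have a phase close to
  \<open>cis s\<close>, so all four terms of \<open>pair_poly\<close> reinforce each other.
\<close>

lemma Re_pair_poly_ge:
  fixes s :: real
  assumes kl: "k \<le> l" "l \<le> k + 1" and d: "d = k + l" "d \<ge> 11" and s: "\<bar>s\<bar> \<le> pi / 2"
  defines "z1 \<equiv> torus_pt ((s + pi / 2) / real d)" and "z2 \<equiv> torus_pt ((s - pi / 2) / real d)"
  shows "Re (cis (- s) * pair_poly k l z1 z2 / \<i> ^ (d + 1)) \<ge> (1 + sqrt 2) ^ d *
    ((1 / 4 + (1 - pi\<^sup>2 / (8 * (real d)\<^sup>2)) / 20) * (2 - 357 / 1000 * ((2 * s\<^sup>2 + pi\<^sup>2 / 2) / real d)) -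
     ((1 / 4) ^ k / 5 + 3 / 5 * ((1 / 4) ^ k)\<^sup>2))"
proof -
  define \<xi>1 \<xi>2 where "\<xi>1 = (s + pi / 2) / real d" and "\<xi>2 = (s - pi / 2) / real d"
  define g1 g2 where "g1 = arsinh (cos \<xi>1)" and "g2 = arsinh (cos \<xi>2)"
  define R where "R = (1 + sqrt 2) ^ d"
  define y :: real where "y = (1 / 4) ^ k"
  define \<kappa> where "\<kappa> = 1 - pi\<^sup>2 / (8 * (real d)\<^sup>2)"
  have d0: "real d > 0" using d by simp
  have "pi / real d \<le> pi / 11" using d by (intro divide_left_mono) auto
  also have "\<dots> \<le> 3 / 10" using pi_approx by simp
  finally have pid: "pi / real d \<le> 3 / 10" .
  have "\<bar>\<xi>1\<bar> \<le> pi / real d" "\<bar>\<xi>2\<bar> \<le> pi / real d"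
    unfolding \<xi>1_def \<xi>2_def abs_divide using s by (auto intro!: divide_right_mono)
  then have \<xi>: "\<bar>\<xi>1\<bar> \<le> 3 / 10" "\<bar>\<xi>2\<bar> \<le> 3 / 10" using pid by linarith+
  note g1 = growth_bounds[OF \<xi>(1), folded g1_def] arsinh_cos_ge_fine[OF \<xi>(1), folded g1_def]
  note g2 = growth_bounds[OF \<xi>(2), folded g2_def] arsinh_cos_ge_fine[OF \<xi>(2), folded g2_def]
  obtain a where a: "\<And>n. cmod (a n) = exp (- real n * g1)"
    "\<And>n. poly (cheb n) z1 = \<i> ^ n * (of_real (exp (real n * g1)) * cis (real n * \<xi>1) + a n) / 2"
  proof -
    have "\<exists>\<eta>. cmod \<eta> = exp (- real n * g1) \<and>
        poly (cheb n) z1 = \<i> ^ n * (of_real (exp (real n * g1)) * cis (real n * \<xi>1) + \<eta>) / 2" for n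
      using cheb_torus_pt[of n \<xi>1] unfolding g1_def z1_def \<xi>1_def[symmetric] by blast
    then show ?thesis using that by metis
  qed
  obtain b where b: "\<And>n. cmod (b n) = exp (- real n * g2)"
    "\<And>n. poly (cheb n) z2 = \<i> ^ n * (of_real (exp (real n * g2)) * cis (real n * \<xi>2) + b n) / 2"
  proof -
    have "\<exists>\<eta>. cmod \<eta> = exp (- real n * g2) \<and>
        poly (cheb n) z2 = \<i> ^ n * (of_real (exp (real n * g2)) * cis (real n * \<xi>2) + \<eta>) / 2" for n
      using cheb_torus_pt[of n \<xi>2] unfolding g2_def z2_def \<xi>2_def[symmetric] by blast
    then show ?thesis using that by metis
  qed
  define V1 V2 where "V1 = (\<lambda>n. of_real (exp (real n * g1)) * cis (real n * \<xi>1) + a n)"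
    and "V2 = (\<lambda>n. of_real (exp (real n * g2)) * cis (real n * \<xi>2) + b n)"
  have V: "poly (cheb n) z1 = \<i> ^ n * V1 n / 2" "poly (cheb n) z2 = \<i> ^ n * V2 n / 2" for n
    by (simp_all add: a b V1_def V2_def)
  have "\<i> ^ k * \<i> ^ l = \<i> ^ d" by (simp add: d power_add)
  then have pp: "pair_poly k l z1 z2 = \<i> ^ d * ((V1 d - V2 d) / 4 + \<i> / 20 * (V1 k * V2 l + V1 l * V2 k))"
    unfolding pair_poly_def V d(1)[symmetric] by (simp add: field_simps)
  have "cis (- s) * pair_poly k l z1 z2 / \<i> ^ (d + 1) =
      (- \<i> * (cis (- s) * V1 d) + \<i> * (cis (- s) * V2 d)) / 4 +
      (cis (- s) * (V1 k * V2 l) + cis (- s) * (V1 l * V2 k)) / 20"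
    unfolding pp by (simp add: field_simps)
  also have "Re \<dots> = (Re (- \<i> * (cis (- s) * V1 d)) + Re (\<i> * (cis (- s) * V2 d))) / 4 +
      (Re (cis (- s) * (V1 k * V2 l)) + Re (cis (- s) * (V1 l * V2 k))) / 20"
    by (simp only: plus_complex.sel Re_divide_numeral)
  finally have eq: "Re (cis (- s) * pair_poly k l z1 z2 / \<i> ^ (d + 1)) = \<dots>" .

  have noise: "exp (- (real d * g)) \<le> R * y\<^sup>2" if "ln 2 \<le> g" for g
  proof -
    have "exp (- (real d * g)) \<le> R * (1 / 4) ^ d" unfolding R_def by (rule exp_noise_le[OF that])
    also have "\<dots> \<le> R * (1 / 4) ^ (2 * k)"
      using kl d(1) unfolding R_def by (intro mult_left_mono power_decreasing) auto
    finally show ?thesis by (simp add: y_def mult.commute flip: power_mult)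
  qed
  have N1: "Re (- \<i> * (cis (- s) * V1 d)) \<ge> R * (1 - 357 / 1000 * real d * \<xi>1\<^sup>2) - R * y\<^sup>2"
  proof -
    have "real d * \<xi>1 = s + pi / 2" using d0 by (simp add: \<xi>1_def)
    then have c: "cis (- s) * cis (real d * \<xi>1) = \<i>" by (simp add: cis_mult)
    have "- \<i> * (cis (- s) * V1 d) =
        of_real (exp (real d * g1)) * (- \<i> * (cis (- s) * cis (real d * \<xi>1))) + (- \<i> * cis (- s) * a d)"
      unfolding V1_def by (simp add: algebra_simps)
    then have "- \<i> * (cis (- s) * V1 d) = of_real (exp (real d * g1)) + (- \<i> * cis (- s) * a d)"
      unfolding c by simp
    moreover have "Re (- \<i> * cis (- s) * a d) \<ge> - cmod (a d)"
      using abs_Re_le_cmod[of "- \<i> * cis (- s) * a d"] by (simp only: norm_mult) (simp add: abs_le_iff)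
    moreover have "cmod (a d) \<le> R * y\<^sup>2"
      unfolding a mult_minus_left by (rule noise[OF g1(2)])
    ultimately show ?thesis
      using exp_growth_ge[OF g1(3) g1(3), of d 0] by (simp add: R_def mult_ac del: times_complex.sel)
  qed
  have N2: "Re (\<i> * (cis (- s) * V2 d)) \<ge> R * (1 - 357 / 1000 * real d * \<xi>2\<^sup>2) - R * y\<^sup>2"
  proof -
    have "real d * \<xi>2 = s - pi / 2" using d0 by (simp add: \<xi>2_def)
    then have c: "cis (- s) * cis (real d * \<xi>2) = - \<i>" by (simp add: cis_mult)
    have "\<i> * (cis (- s) * V2 d) =
        of_real (exp (real d * g2)) * (\<i> * (cis (- s) * cis (real d * \<xi>2))) + (\<i> * cis (- s) * b d)"
      unfolding V2_def by (simp add: algebra_simps)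
    then have "\<i> * (cis (- s) * V2 d) = of_real (exp (real d * g2)) + (\<i> * cis (- s) * b d)"
      unfolding c by simp
    moreover have "Re (\<i> * cis (- s) * b d) \<ge> - cmod (b d)"
      using abs_Re_le_cmod[of "\<i> * cis (- s) * b d"] by (simp only: norm_mult) (simp add: abs_le_iff)
    moreover have "cmod (b d) \<le> R * y\<^sup>2"
      unfolding b mult_minus_left by (rule noise[OF g2(2)])
    ultimately show ?thesis
      using exp_growth_ge[OF g2(3) g2(3), of d 0] by (simp add: R_def mult_ac del: times_complex.sel)
  qed
  have "pi\<^sup>2 \<le> 8 * (real d)\<^sup>2"
    using pi_square_le power_mono[of 11 "real d" 2] d by (simp add: power2_eq_square)
  then have \<kappa>: "\<kappa> \<ge> 0" unfolding \<kappa>_def using d0 by simp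
  have P: "Re (cis (- s) * (V1 m * V2 n)) \<ge>
      R * (\<kappa> * (1 - 357 / 1000 * (real m * \<xi>1\<^sup>2 + real n * \<xi>2\<^sup>2))) - R * (2 * y + y\<^sup>2)"
    if mn: "m + n = d" "k \<le> m" "k \<le> n" "\<bar>real m - real n\<bar> \<le> 1" for m n
  proof -
    have ang: "real m * \<xi>1 + real n * \<xi>2 - s = (real m - real n) * (pi / (2 * real d))"
    proof -
      have "real m * \<xi>1 + real n * \<xi>2 = ((real m + real n) * s + (real m - real n) * (pi / 2)) / real d"
        unfolding \<xi>1_def \<xi>2_def times_divide_eq_right add_divide_distrib[symmetric]
        by (intro arg_cong2[of _ _ _ _ "(/)"] refl) (simp add: field_simps)
      also have "real m + real n = real d" by (simp flip: mn(1))
      finally show ?thesis using d0 by (simp add: add_divide_distrib)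
    qed
    \<comment> \<open>As \<open>m\<close> and \<open>n\<close> differ by at most 1, the phase of the
      product misses \<open>s\<close> by at most \<open>pi / (2 * d)\<close>;
      \<open>\<kappa>\<close> bounds the cosine of this error from below.\<close>
    have "((real m - real n) * (pi / (2 * real d)))\<^sup>2 \<le> 1 * (pi / (2 * real d))\<^sup>2"
      unfolding power_mult_distrib using mn(4) by (intro mult_right_mono) (auto simp: abs_square_le_1)
    then have "cos (real m * \<xi>1 + real n * \<xi>2 - s) \<ge> \<kappa>"
      using one_minus_square_le_cos[of "(real m - real n) * (pi / (2 * real d))"]
      unfolding ang \<kappa>_def by (simp add: power_divide power_mult_distrib)
    then have "\<kappa> * (exp (real m * g1) * exp (real n * g2)) \<le>
        cos (real m * \<xi>1 + real n * \<xi>2 - s) * (exp (real m * g1) * exp (real n * g2))"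
      by (rule mult_right_mono) simp
    moreover have "\<kappa> * (R * (1 - (real m * (357 / 1000 * \<xi>1\<^sup>2) + real n * (357 / 1000 * \<xi>2\<^sup>2)))) \<le>
        \<kappa> * (exp (real m * g1) * exp (real n * g2))"
      using exp_growth_ge[OF g1(3) g2(3), of m n] \<kappa> unfolding R_def mn(1) by (rule mult_left_mono)
    moreover have "exp (real m * g1) * cmod (b n) \<le> R * y"
      using exp_mixed_noise_le[OF g1(1) g2(2) mn(3), of m] by (simp add: b R_def y_def mn(1))
    moreover have "cmod (a m) * exp (real n * g2) \<le> R * y"
      using exp_mixed_noise_le[OF g2(1) g1(2) mn(2), of n] by (simp add: a R_def y_def mn(1)[symmetric] mult.commute add.commute)
    moreover have "cmod (a m) * cmod (b n) \<le> R * y\<^sup>2"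
    proof -
      have "cmod (a m) * cmod (b n) \<le> ((1 + sqrt 2) ^ m * (1 / 4) ^ m) * ((1 + sqrt 2) ^ n * (1 / 4) ^ n)"
        unfolding a b using exp_noise_le[OF g1(2), of m] exp_noise_le[OF g2(2), of n] by (intro mult_mono) auto
      also have "\<dots> = R * (1 / 4) ^ d" by (simp add: R_def power_add flip: mn(1))
      also have "\<dots> \<le> R * (1 / 4) ^ (2 * k)"
        using mn unfolding R_def by (intro mult_left_mono power_decreasing) auto
      finally show ?thesis by (simp add: y_def mult.commute flip: power_mult)
    qed
    moreover have "exp (real m * g1) * exp (real n * g2) * cos (real m * \<xi>1 + real n * \<xi>2 - s) -
        (exp (real m * g1) * cmod (b n) + cmod (a m) * exp (real n * g2) + cmod (a m) * cmod (b n)) \<le>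
        Re (cis (- s) * (V1 m * V2 n))"
      unfolding V1_def V2_def by (rule Re_perturbed_product_ge) auto
    moreover have "R * (\<kappa> * (1 - 357 / 1000 * (real m * \<xi>1\<^sup>2 + real n * \<xi>2\<^sup>2))) =
        \<kappa> * (R * (1 - (real m * (357 / 1000 * \<xi>1\<^sup>2) + real n * (357 / 1000 * \<xi>2\<^sup>2))))"
      "R * (2 * y + y\<^sup>2) = R * y + R * y + R * y\<^sup>2"
      by (simp_all add: algebra_simps)
    ultimately show ?thesis
      unfolding mult.commute[of "cos (real m * \<xi>1 + real n * \<xi>2 - s)"] by linarith
  qed
  have S: "real d * (\<xi>1\<^sup>2 + \<xi>2\<^sup>2) = (2 * s\<^sup>2 + pi\<^sup>2 / 2) / real d"
    using d0 by (simp add: \<xi>1_def \<xi>2_def field_simps power2_eq_square)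
  have P1: "Re (cis (- s) * (V1 k * V2 l)) \<ge>
      R * (\<kappa> * (1 - 357 / 1000 * (real k * \<xi>1\<^sup>2 + real l * \<xi>2\<^sup>2))) - R * (2 * y + y\<^sup>2)"
    using kl d by (intro P) auto
  have P2: "Re (cis (- s) * (V1 l * V2 k)) \<ge>
      R * (\<kappa> * (1 - 357 / 1000 * (real l * \<xi>1\<^sup>2 + real k * \<xi>2\<^sup>2))) - R * (2 * y + y\<^sup>2)"
    using kl d by (intro P) auto
  \<comment> \<open>In the sum of \<open>P1\<close> and \<open>P2\<close> both squares get the
    weight \<open>k + l = d\<close>. The errors add up to \<open>R\<close> times
    \<open>2 * y\<^sup>2 / 4 + 2 * (2 * y + y\<^sup>2) / 20\<close>.\<close>
  have "R * ((1 / 4 + \<kappa> / 20) * (2 - 357 / 1000 * (real d * (\<xi>1\<^sup>2 + \<xi>2\<^sup>2))) - (y / 5 + 3 / 5 * y\<^sup>2)) =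
     ((R * (1 - 357 / 1000 * real d * \<xi>1\<^sup>2) - R * y\<^sup>2) + (R * (1 - 357 / 1000 * real d * \<xi>2\<^sup>2) - R * y\<^sup>2)) / 4 +
     ((R * (\<kappa> * (1 - 357 / 1000 * (real k * \<xi>1\<^sup>2 + real l * \<xi>2\<^sup>2))) - R * (2 * y + y\<^sup>2)) +
      (R * (\<kappa> * (1 - 357 / 1000 * (real l * \<xi>1\<^sup>2 + real k * \<xi>2\<^sup>2))) - R * (2 * y + y\<^sup>2))) / 20"
    unfolding d(1) of_nat_add by (simp add: field_simps)
  also have "\<dots> \<le> Re (cis (- s) * pair_poly k l z1 z2 / \<i> ^ (d + 1))"
    unfolding eq using N1 N2 P1 P2 by (intro add_mono divide_right_mono) auto
  finally show ?thesis unfolding S R_def \<kappa>_def y_def .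
qed

text \<open>\<open>J\<close> copies of \<open>pair_poly\<close> use the even coordinates for
  \<open>x\<close> and the odd ones for \<open>y\<close>. The mean of
  \<open>2 * s\<^sup>2 + pi\<^sup>2 / 2\<close> over the phases is at most
  \<open>2 * pi\<^sup>2 / 3\<close>, and the lens estimate supplies the denominator.\<close>

lemma C2_lower_large:
  assumes d: "d \<ge> 11" and k: "k = d div 2"
    and K: "K = (1 + sqrt 2) ^ d *
    ((1 / 4 + (1 - pi\<^sup>2 / (8 * (real d)\<^sup>2)) / 20) * (2 - 357 / 1000 * ((2 * pi\<^sup>2 / 3) / real d)) -
     ((1 / 4) ^ k / 5 + 3 / 5 * ((1 / 4) ^ k)\<^sup>2))" "K > 0"
  shows "ereal (K * 25 / (5 * sqrt 26 + ln (5 + sqrt 26)) * (pi / 2)) \<le> C2 d"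
proof (rule C2_lower_limit)
  fix J :: nat assume J: "J > 0"
  define s where "s = phase J"
  define l where "l = d - k"
  have kl: "k \<le> l" "l \<le> k + 1" "d = k + l" using k by (auto simp: l_def)
  define L where "L = 5 * sqrt 26 + ln (5 + sqrt 26)"
  have L: "L > 0" unfolding L_def by (intro add_pos_nonneg) auto
  define F where "F = (\<lambda>x :: nat \<Rightarrow> complex. \<Sum>j<J. cis (- s j) * pair_poly k l (x (2 * j)) (x (2 * j + 1)))"
  define \<zeta> where "\<zeta> = (\<lambda>v. torus_pt ((s (v div 2) + (if even v then pi / 2 else - (pi / 2))) / real d))"
  have "cmod (F \<zeta>) \<ge> real J * K"
  proof -
    define A where "A = (1 + sqrt 2) ^ d * (1 / 4 + (1 - pi\<^sup>2 / (8 * (real d)\<^sup>2)) / 20)"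
    define E where "E = (1 + sqrt 2) ^ d * ((1 / 4) ^ k / 5 + 3 / 5 * ((1 / 4) ^ k)\<^sup>2)"
    have K': "K = A * (2 - 357 / 1000 * ((2 * pi\<^sup>2 / 3) / real d)) - E"
      unfolding K(1) A_def E_def by (simp add: right_diff_distrib mult.assoc)
    have "pi\<^sup>2 \<le> 8 * (real d)\<^sup>2"
      using pi_square_le power_mono[of 11 "real d" 2] d by (simp add: power2_eq_square)
    then have "pi\<^sup>2 / (8 * (real d)\<^sup>2) \<le> 1" using d by simp
    then have A: "A \<ge> 0" unfolding A_def by (intro mult_nonneg_nonneg) auto
    have "(\<Sum>j<J. 2 * (s j)\<^sup>2 + pi\<^sup>2 / 2) = 2 * (\<Sum>j<J. (s j)\<^sup>2) + real J * (pi\<^sup>2 / 2)"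
      by (simp add: sum.distrib sum_distrib_left)
    also have "\<dots> \<le> real J * (2 * pi\<^sup>2 / 3)"
      using sum_phase_square_le[OF J] unfolding s_def by (simp add: algebra_simps)
    finally have sq: "(\<Sum>j<J. 2 * (s j)\<^sup>2 + pi\<^sup>2 / 2) \<le> real J * (2 * pi\<^sup>2 / 3)" .
    have "real J * K = A * (2 * real J - 357 / 1000 * (real J * (2 * pi\<^sup>2 / 3)) / real d) - real J * E"
      unfolding K' by (simp add: algebra_simps)
    also have "\<dots> \<le> A * (2 * real J - 357 / 1000 * (\<Sum>j<J. 2 * (s j)\<^sup>2 + pi\<^sup>2 / 2) / real d) - real J * E"
      using A sq by (intro diff_right_mono mult_left_mono diff_left_mono divide_right_mono) auto
    also have "\<dots> = (\<Sum>j<J. A * (2 - 357 / 1000 * ((2 * (s j)\<^sup>2 + pi\<^sup>2 / 2) / real d)) - E)"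
    proof -
      have "A * (2 * real J - c * (\<Sum>j<J. w j) / r) - real J * E = (\<Sum>j<J. A * (2 - c * (w j / r)) - E)"
        for w c r
        by (simp add: sum_subtractf sum_distrib_left sum_divide_distrib right_diff_distrib)
      then show ?thesis .
    qed
    also have "\<dots> \<le> (\<Sum>j<J. Re (cis (- s j) * pair_poly k l (\<zeta> (2 * j)) (\<zeta> (2 * j + 1)) / \<i> ^ (d + 1)))"
    proof (rule sum_mono)
      fix j assume "j \<in> {..<J}"
      then have "\<bar>s j\<bar> \<le> pi / 2" unfolding s_def using abs_phase_le by simp
      from Re_pair_poly_ge[OF kl d this]
      show "A * (2 - 357 / 1000 * ((2 * (s j)\<^sup>2 + pi\<^sup>2 / 2) / real d)) - E \<le>
          Re (cis (- s j) * pair_poly k l (\<zeta> (2 * j)) (\<zeta> (2 * j + 1)) / \<i> ^ (d + 1))"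
        unfolding A_def E_def \<zeta>_def by (simp only: right_diff_distrib mult.assoc) simp
    qed
    also have "\<dots> = Re (F \<zeta> / \<i> ^ (d + 1))"
      unfolding F_def sum_divide_distrib Re_sum ..
    also have "\<dots> \<le> cmod (F \<zeta> / \<i> ^ (d + 1))" by (rule complex_Re_le_cmod)
    also have "\<dots> = cmod (F \<zeta>)" by (simp add: norm_divide norm_mult norm_power)
    finally show ?thesis .
  qed
  moreover have "cmod (F x) \<le> L / 25 / sin (pi / (2 * real J))"
    if x: "\<And>v. v < 2 * J \<Longrightarrow> x v \<in> of_real ` {-1..1}" for x
  proof (rule norm_le_of_real_parts)
    fix \<psi>
    have "\<exists>t. v < 2 * J \<longrightarrow> x v = of_real (cos t)" for v
      using x[of v] cube_pointE by blast
    then obtain t where t: "\<And>v. v < 2 * J \<Longrightarrow> x v = of_real (cos (t v))" by metis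
    define X where "X = (\<lambda>j. (cos (real (k + l) * t (2 * j)) - cos (real (k + l) * t (2 * j + 1))) / 2)"
    define U where "U = (\<lambda>j. (cos (real k * t (2 * j)) * cos (real l * t (2 * j + 1)) +
        cos (real l * t (2 * j)) * cos (real k * t (2 * j + 1))) / 2)"
    have "Re (cis (- \<psi>) * F x) =
        (\<Sum>j<J. X j * cos (\<psi> + phase J j) + 2 * (1 / 5) * U j * sin (\<psi> + phase J j))"
      unfolding F_def sum_distrib_left Re_sum
    proof (intro sum.cong refl)
      fix j assume "j \<in> {..<J}"
      then have "x (2 * j) = of_real (cos (t (2 * j)))" "x (2 * j + 1) = of_real (cos (t (2 * j + 1)))"
        by (auto intro: t)
      then have "pair_poly k l (x (2 * j)) (x (2 * j + 1)) = Complex (X j) (2 * (1 / 5) * U j)"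
        by (simp only: pair_poly_real X_def U_def)
      moreover have "cis (- \<psi>) * cis (- s j) = cis (- (\<psi> + s j))" by (simp add: cis_mult)
      ultimately have "cis (- \<psi>) * (cis (- s j) * pair_poly k l (x (2 * j)) (x (2 * j + 1))) =
          cis (- (\<psi> + s j)) * Complex (X j) (2 * (1 / 5) * U j)"
        by (simp only: mult.assoc[symmetric])
      also have "Re \<dots> = X j * cos (\<psi> + phase J j) + 2 * (1 / 5) * U j * sin (\<psi> + phase J j)"
        unfolding s_def times_complex.sel cis.sel complex.sel cos_minus sin_minus by simp
      finally show "Re (cis (- \<psi>) * (cis (- s j) * pair_poly k l (x (2 * j)) (x (2 * j + 1)))) =
          X j * cos (\<psi> + phase J j) + 2 * (1 / 5) * U j * sin (\<psi> + phase J j)" .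
    qed
    also have "\<dots> \<le> L / 25 / sin (pi / (2 * real J))"
      unfolding L_def X_def U_def by (intro sum_lens_support_le[OF J] cos_pair_bound)
    finally show "Re (cis (- \<psi>) * F x) \<le> L / 25 / sin (pi / (2 * real J))" .
  qed
  moreover have "approximable (2 * J) d F"
    unfolding F_def kl(3) by (intro approximable_sum approximable_cmult approximable_pair_poly) auto
  ultimately have "ereal (real J * K / (L / 25 / sin (pi / (2 * real J)))) \<le> C2 d"
    using J K(2) L sin_half_step_pos[OF J]
    by (intro C2_lower_approximable[of "2 * J" d F _ \<zeta>]) (auto simp: \<zeta>_def cmod_torus_pt)
  then show "ereal (K * 25 / (5 * sqrt 26 + ln (5 + sqrt 26)) * (real J * sin (pi / (2 * real J)))) \<le> C2 d"
    unfolding L_def[symmetric] by (simp add: mult_ac)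
qed

section \<open>Numerical verification for degrees from 11 on\<close>

text \<open>As \<open>d \<le> 2 * k + 1\<close>, this bounds the noise \<open>(1 / 4) ^ k\<close> by
  \<open>1 / (8 * d\<^sup>2)\<close>.\<close>

lemma square_le_power4:
  assumes "k \<ge> (5::nat)"
  shows "8 * (2 * k + 1)\<^sup>2 \<le> 4 ^ k"
  using assms
proof (induction k rule: dec_induct)
  case (step n)
  have "8 * (2 * Suc n + 1)\<^sup>2 \<le> 4 * (8 * (2 * n + 1)\<^sup>2)"
    using step(1) by (simp add: power2_eq_square algebra_simps)
  then show ?case using step by simp
qed simp

text \<open>The leading term is \<open>3 / 5 = 2 * (1 / 4 + 1 / 20)\<close>. The first-order loss is
  about \<open>0.705 / d\<close>, while \<open>0.72 / d\<close> is allowed; the margin of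
  \<open>0.015 / d\<close> absorbs the terms of order \<open>1 / d\<^sup>2\<close>.\<close>

lemma large_degree_estimate:
  assumes d: "d \<ge> 11" and k: "k = d div 2"
  shows "3 / 5 * (1 - 6 / (5 * real d)) \<le>
    (1 / 4 + (1 - pi\<^sup>2 / (8 * (real d)\<^sup>2)) / 20) * (2 - 357 / 1000 * ((2 * pi\<^sup>2 / 3) / real d)) -
     ((1 / 4) ^ k / 5 + 3 / 5 * ((1 / 4) ^ k)\<^sup>2)"
proof -
  define t where "t = 1 / real d"
  define y :: real where "y = (1 / 4) ^ k"
  have t: "0 < t" "t \<le> 1 / 11" using d by (auto simp: t_def field_simps)
  have k5: "k \<ge> 5" using d k by auto
  have "d\<^sup>2 \<le> (2 * k + 1)\<^sup>2" using k by (intro power_mono) auto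
  then have "8 * d\<^sup>2 \<le> 4 ^ k" using square_le_power4[OF k5] by linarith
  then have "real (8 * d\<^sup>2) \<le> real (4 ^ k)" by (simp only: of_nat_le_iff)
  then have "8 * (real d)\<^sup>2 \<le> 4 ^ k" by simp
  then have "y \<le> t\<^sup>2 / 8"
    using d by (simp add: y_def t_def power_one_over divide_simps)
  moreover have "y \<ge> 0" "y \<le> (1 / 4) ^ 5" unfolding y_def using k5 by (auto intro!: power_decreasing)
  then have "y \<ge> 0" "y \<le> 1 / 1024" by (simp_all add: power_one_over)
  then have "y\<^sup>2 \<le> (1 / 1024) * y" using mult_right_mono[of y "1 / 1024" y] by (simp add: power2_eq_square)
  ultimately have Y: "y / 5 + 3 / 5 * y\<^sup>2 \<le> 26 / 1000 * t\<^sup>2"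
    using zero_le_power2[of t] by linarith
  define p where "p = pi\<^sup>2"
  have p: "0 \<le> p" "p \<le> 987 / 100" using pi_square_le by (auto simp: p_def)
  \<comment> \<open>With \<open>p \<le> 9.87\<close>, the constants round up
    \<open>9.87 / 160\<close> and \<open>0.357 * 6.58\<close>.\<close>
  have "(3 / 10 - 6169 / 100000 * t\<^sup>2) * (2 - 23491 / 10000 * t) \<le>
      (1 / 4 + (1 - p / 8 * t\<^sup>2) / 20) * (2 - 357 / 1000 * ((2 * p / 3) * t))"
  proof (rule mult_mono)
    have "3 / 10 - 6169 / 100000 * r \<le> 1 / 4 + (1 - q) / 20" if "q \<le> 987 / 800 * r" "0 \<le> r" for q r :: real
      using that by (simp add: field_simps)
    moreover have "p / 8 * t\<^sup>2 \<le> 987 / 800 * t\<^sup>2" using p by (intro mult_right_mono) auto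
    ultimately show "3 / 10 - 6169 / 100000 * t\<^sup>2 \<le> 1 / 4 + (1 - p / 8 * t\<^sup>2) / 20"
      by simp
    then show "0 \<le> 1 / 4 + (1 - p / 8 * t\<^sup>2) / 20"
      using power_mono[of t "1 / 11" 2] t by (simp add: power2_eq_square)
    have "2 * p / 3 * t \<le> 658 / 100 * t" using p t by (intro mult_right_mono) auto
    then show "2 - 23491 / 10000 * t \<le> 2 - 357 / 1000 * ((2 * p / 3) * t)" using t by simp
  qed (use t in simp)
  moreover have "3 / 5 * (1 - 6 / 5 * t) \<le> (3 / 10 - 6169 / 100000 * t\<^sup>2) * (2 - 23491 / 10000 * t) - 26 / 1000 * t\<^sup>2"
  proof -
    have "t * (15 / 1000 - 15 / 100 * t) \<ge> 0" using t by (intro mult_nonneg_nonneg) auto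
    then have *: "15 / 100 * t\<^sup>2 \<le> 15 / 1000 * t" by (simp add: power2_eq_square algebra_simps)
    have e: "(3 / 10 - 6169 / 100000 * t\<^sup>2) * (2 - 23491 / 10000 * t) - 26 / 1000 * t\<^sup>2 =
        3 / 5 - 70473 / 100000 * t - 14938 / 100000 * t\<^sup>2 + 6169 / 100000 * (23491 / 10000) * (t\<^sup>2 * t)"
      by (simp add: field_simps)
    have "t\<^sup>2 * t \<ge> 0" using t by simp
    moreover have "3 / 5 * (1 - 6 / 5 * t) \<le> 3 / 5 - 70473 / 100000 * t - 14938 / 100000 * q + 6169 / 100000 * (23491 / 10000) * r"
      if "15 / 100 * q \<le> 15 / 1000 * t" "r \<ge> 0" for q r :: real
      using that t by simp
    ultimately show ?thesis unfolding e using * by blast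
  qed
  ultimately have "3 / 5 * (1 - 6 / 5 * t) \<le>
      (1 / 4 + (1 - p / 8 * t\<^sup>2) / 20) * (2 - 357 / 1000 * ((2 * p / 3) * t)) - (y / 5 + 3 / 5 * y\<^sup>2)"
    using Y by linarith
  then show ?thesis by (simp add: t_def p_def y_def power_one_over)
qed

lemma beta_lower_large:
  assumes d: "d \<ge> 11"
  shows "ereal (beta_const * (1 - 6 / (5 * real d)) * (1 + sqrt 2) ^ d) \<le> C2 d"
proof -
  define k where "k = d div 2"
  define L where "L = 5 * sqrt 26 + ln (5 + sqrt 26)"
  have L: "L > 0" unfolding L_def by (intro add_pos_nonneg) auto
  define K where "K = (1 + sqrt 2) ^ d *
    ((1 / 4 + (1 - pi\<^sup>2 / (8 * (real d)\<^sup>2)) / 20) * (2 - 357 / 1000 * ((2 * pi\<^sup>2 / 3) / real d)) -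
     ((1 / 4) ^ k / 5 + 3 / 5 * ((1 / 4) ^ k)\<^sup>2))"
  have K: "(1 + sqrt 2) ^ d * (3 / 5 * (1 - 6 / (5 * real d))) \<le> K"
    unfolding K_def using large_degree_estimate[OF d k_def] by (intro mult_left_mono) auto
  have "1 - 6 / (5 * real d) > 0" using d by (simp add: field_simps)
  then have "(1 + sqrt 2) ^ d * (3 / 5 * (1 - 6 / (5 * real d))) > 0"
    by (intro mult_pos_pos zero_less_power add_pos_pos) auto
  then have K0: "K > 0" using K by linarith
  \<comment> \<open>The constants combine as
    \<open>3 / 5 * 25 * (pi / 2) = 15 * pi / 2\<close>.\<close>
  have "beta_const * (1 - 6 / (5 * real d)) * (1 + sqrt 2) ^ d =
      (1 + sqrt 2) ^ d * (3 / 5 * (1 - 6 / (5 * real d))) * (25 / L * (pi / 2))"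
    unfolding beta_const_def L_def[symmetric] using L by (simp add: field_simps)
  also have "\<dots> \<le> K * (25 / L * (pi / 2))"
    using K L by (intro mult_right_mono) auto
  finally have "ereal (beta_const * (1 - 6 / (5 * real d)) * (1 + sqrt 2) ^ d) \<le> ereal (K * 25 / L * (pi / 2))"
    by simp
  also have "\<dots> \<le> C2 d"
    unfolding L_def by (rule C2_lower_large[OF d k_def K_def K0])
  finally show ?thesis .
qed

section \<open>Conclusion\<close>

lemma C2_lower_bound:
  assumes "d \<ge> 3"
  shows "ereal (beta_const * (1 - 6 / (5 * real d)) * (1 + sqrt 2) ^ d) \<le> C2 d"
  using assms beta_lower_small[of d] beta_lower_large[of d] by (cases "d \<le> 10") auto

lemma beta_const_pos: "beta_const > 0"
  unfolding beta_const_def by (intro divide_pos_pos mult_pos_pos add_pos_nonneg) auto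

lemma beta_correction_tendsto:
  "(\<lambda>d. beta_const * (1 - 6 / (5 * real d))) \<longlonglongrightarrow> beta_const"
proof -
  have "(\<lambda>d. 1 - 6 / (5 * real d)) \<longlonglongrightarrow> 1" by real_asymp
  from tendsto_mult_left[OF this, of beta_const] show ?thesis by simp
qed

theorem theorem2:
  shows "(\<forall>d::nat. d \<ge> 3 \<longrightarrow>
            ereal (beta_const * (1 - 6 / (5 * real d)) * (1 + sqrt 2) ^ d) \<le> C2 d \<and>
            C2 d \<le> ereal ((1 + sqrt 2) ^ d)) \<and>
         ereal beta_const \<le> liminf (\<lambda>d. C2 d / ereal ((1 + sqrt 2) ^ d)) \<and>
         liminf (\<lambda>d. C2 d / ereal ((1 + sqrt 2) ^ d)) \<le> limsup (\<lambda>d. C2 d / ereal ((1 + sqrt 2) ^ d)) \<and>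
         limsup (\<lambda>d. C2 d / ereal ((1 + sqrt 2) ^ d)) \<le> 1 \<and>
         (\<lambda>d. real_of_ereal (C2 d) powr (1 / real d)) \<longlonglongrightarrow> 1 + sqrt 2"
proof (intro conjI allI impI C2_lower_bound C2_upper)
  have R: "1 + sqrt 2 > 0" by (simp add: add_pos_pos)
  have Rd: "(1 + sqrt 2) ^ d > 0" for d using R by simp
  show "ereal beta_const \<le> liminf (\<lambda>d. C2 d / ereal ((1 + sqrt 2) ^ d))"
  proof -
    have "(\<lambda>d. ereal (beta_const * (1 - 6 / (5 * real d)))) \<longlonglongrightarrow> ereal beta_const"
      using beta_correction_tendsto by simp
    then have "ereal beta_const = liminf (\<lambda>d. ereal (beta_const * (1 - 6 / (5 * real d))))"
      by (intro lim_imp_Liminf[symmetric]) auto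
    also have "\<dots> \<le> liminf (\<lambda>d. C2 d / ereal ((1 + sqrt 2) ^ d))"
    proof (intro Liminf_mono eventually_sequentiallyI[of 3])
      fix d :: nat assume "d \<ge> 3"
      then show "ereal (beta_const * (1 - 6 / (5 * real d))) \<le> C2 d / ereal ((1 + sqrt 2) ^ d)"
        using C2_lower_bound[of d] Rd[of d] by (subst ereal_le_divide_pos) (auto simp: mult_ac)
    qed
    finally show ?thesis .
  qed
  show "liminf (\<lambda>d. C2 d / ereal ((1 + sqrt 2) ^ d)) \<le> limsup (\<lambda>d. C2 d / ereal ((1 + sqrt 2) ^ d))"
    by (rule Liminf_le_Limsup) simp
  show "limsup (\<lambda>d. C2 d / ereal ((1 + sqrt 2) ^ d)) \<le> 1"
    using C2_upper Rd by (intro Limsup_bounded always_eventually allI) (simp add: ereal_divide_le_pos)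
  show "(\<lambda>d. real_of_ereal (C2 d) powr (1 / real d)) \<longlonglongrightarrow> 1 + sqrt 2"
  proof (rule tendsto_sandwich)
    \<comment> \<open>The two-sided bound makes \<open>C2 d\<close> finite, so
      \<open>real_of_ereal\<close> gives its true value.\<close>
    have bounds: "beta_const * (1 - 6 / (5 * real d)) * (1 + sqrt 2) ^ d \<le> real_of_ereal (C2 d)"
      "real_of_ereal (C2 d) \<le> (1 + sqrt 2) ^ d" "beta_const * (1 - 6 / (5 * real d)) > 0" if "d \<ge> 3" for d
    proof -
      show "beta_const * (1 - 6 / (5 * real d)) > 0"
        using that beta_const_pos by (intro mult_pos_pos) (auto simp: field_simps)
      show "beta_const * (1 - 6 / (5 * real d)) * (1 + sqrt 2) ^ d \<le> real_of_ereal (C2 d)"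
        "real_of_ereal (C2 d) \<le> (1 + sqrt 2) ^ d"
        using C2_lower_bound[OF that] C2_upper[of d] by (cases "C2 d"; simp)+
    qed
    have root: "((1 + sqrt 2) ^ d) powr (1 / real d) = 1 + sqrt 2" if "d \<ge> 3" for d
      using that R by (simp add: powr_powr flip: powr_realpow)
    show "\<forall>\<^sub>F d in sequentially. (beta_const * (1 - 6 / (5 * real d))) powr (1 / real d) * (1 + sqrt 2) \<le>
        real_of_ereal (C2 d) powr (1 / real d)"
    proof (rule eventually_sequentiallyI[of 3])
      fix d :: nat assume d: "d \<ge> 3"
      have "(beta_const * (1 - 6 / (5 * real d))) powr (1 / real d) * (1 + sqrt 2) =
          (beta_const * (1 - 6 / (5 * real d)) * (1 + sqrt 2) ^ d) powr (1 / real d)"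
        using bounds(3)[OF d] Rd[of d] root[OF d] by (subst powr_mult) auto
      also have "\<dots> \<le> real_of_ereal (C2 d) powr (1 / real d)"
        using bounds[OF d] Rd[of d] by (intro powr_mono2) auto
      finally show "(beta_const * (1 - 6 / (5 * real d))) powr (1 / real d) * (1 + sqrt 2) \<le>
          real_of_ereal (C2 d) powr (1 / real d)" .
    qed
    show "\<forall>\<^sub>F d in sequentially. real_of_ereal (C2 d) powr (1 / real d) \<le> 1 + sqrt 2"
    proof (rule eventually_sequentiallyI[of 3])
      fix d :: nat assume d: "d \<ge> 3"
      have "0 \<le> real_of_ereal (C2 d)" using bounds[OF d] Rd[of d] by (smt (verit) mult_pos_pos)
      then have "real_of_ereal (C2 d) powr (1 / real d) \<le> ((1 + sqrt 2) ^ d) powr (1 / real d)"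
        using bounds(2)[OF d] by (intro powr_mono2) auto
      then show "real_of_ereal (C2 d) powr (1 / real d) \<le> 1 + sqrt 2" using root[OF d] by simp
    qed
    \<comment> \<open>The factor in front of \<open>(1 + sqrt 2) ^ d\<close> tends to a positive
      limit, so its \<open>d\<close>-th root tends to 1.\<close>
    have "(\<lambda>d. (beta_const * (1 - 6 / (5 * real d))) powr (1 / real d) * (1 + sqrt 2)) \<longlonglongrightarrow>
        beta_const powr 0 * (1 + sqrt 2)"
      using beta_const_pos by (intro tendsto_intros beta_correction_tendsto lim_1_over_n) auto
    then show "(\<lambda>d. (beta_const * (1 - 6 / (5 * real d))) powr (1 / real d) * (1 + sqrt 2)) \<longlonglongrightarrow> 1 + sqrt 2"
      using beta_const_pos by simp
  qed simp
qed

end
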